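(* For every $\alpha\in(0,2)$ and $p>0$ there exist constants $\mathcal C_1,\mathcal C_2>0$ such that $\big|\mathbb E[(\xi_\alpha^\delta(T))^p]-\mathbb E[(\xi_\alpha^\delta)^p]\big|\le \mathcal C_1e^{-\mathcal C_2T^\alpha}$ for all $(\delta,T)\in[0,1]\times[1,\infty)$.
   Context: $B_\alpha$ is fractional Brownian motion with $\mathrm{Cov}(B_\alpha(t),B_\alpha(s))=\frac{|t|^\alpha+|s|^\alpha-|t-s|^\alpha}{2}$, $t,s\in\mathbb R$, and $Z_\alpha(t)=\sqrt2B_\alpha(t)-|t|^\alpha$. For $a\le b$, $\delta>0$ let $[a,b]_\delta=[a,b]\cap\delta\mathbb Z$. For $\delta>0$: $\xi_\alpha^\delta=\dfrac{\sup_{t\in\delta\mathbb Z}e^{Z_\alpha(t)}}{\delta\sum_{t\in\delta\mathbb Z}e^{Z_\alpha(t)}}$ and $\xi_\alpha^\delta(T)=\dfrac{\sup_{t\in[-T,T]_\delta}e^{Z_\alpha(t)}}{\delta\sum_{t\in[-T,T]_\delta}e^{Z_\alpha(t)}}$. For $\delta=0$, the suprema are over $\mathbb R$ and $[-T,T]$ respectively and the denominators are $\int_{\mathbb R}e^{Z_\alpha(t)}dt$ and $\int_{-T}^Te^{Z_\alpha(t)}dt$. *)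

theory Defs
  imports "HOL-Probability.Probability"
begin

definition fbm_cov :: "real \<Rightarrow> real \<Rightarrow> real \<Rightarrow> real" where
  "fbm_cov \<alpha> s t = (\<bar>t\<bar> powr \<alpha> + \<bar>s\<bar> powr \<alpha> - \<bar>t - s\<bar> powr \<alpha>) / 2"

definition is_fbm :: "'a measure \<Rightarrow> real \<Rightarrow> (real \<Rightarrow> 'a \<Rightarrow> real) \<Rightarrow> bool" where
  "is_fbm M \<alpha> B \<longleftrightarrow> prob_space M \<and>
     (\<forall>t. B t \<in> borel_measurable M) \<and>
     (\<forall>\<omega>\<in>space M. continuous_on UNIV (\<lambda>t. B t \<omega>)) \<and>
     (\<forall>(F::real set) (c::real \<Rightarrow> real). finite F \<longrightarrow>
        (let X = (\<lambda>\<omega>. \<Sum>t\<in>F. c t * B t \<omega>);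
             v = (\<Sum>s\<in>F. \<Sum>t\<in>F. c s * c t * fbm_cov \<alpha> s t)
         in if v > 0 then distributed M lborel X (normal_density 0 (sqrt v))
            else (AE \<omega> in M. X \<omega> = 0)))"

definition Zp :: "real \<Rightarrow> (real \<Rightarrow> 'a \<Rightarrow> real) \<Rightarrow> 'a \<Rightarrow> real \<Rightarrow> real" where
  "Zp \<alpha> B \<omega> t = sqrt 2 * B t \<omega> - \<bar>t\<bar> powr \<alpha>"

definition xi :: "real \<Rightarrow> (real \<Rightarrow> 'a \<Rightarrow> real) \<Rightarrow> real \<Rightarrow> 'a \<Rightarrow> real" where
  "xi \<alpha> B \<delta> \<omega> =
     (if \<delta> = 0 then
        (SUP t::real. exp (Zp \<alpha> B \<omega> t)) / (\<integral>t. exp (Zp \<alpha> B \<omega> t) \<partial>lborel)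
      else
        (SUP k::int. exp (Zp \<alpha> B \<omega> (\<delta> * of_int k))) /
        (\<delta> * (\<Sum>\<^sub>\<infinity>k::int. exp (Zp \<alpha> B \<omega> (\<delta> * of_int k)))))"

definition xiT :: "real \<Rightarrow> (real \<Rightarrow> 'a \<Rightarrow> real) \<Rightarrow> real \<Rightarrow> real \<Rightarrow> 'a \<Rightarrow> real" where
  "xiT \<alpha> B \<delta> T \<omega> =
     (if \<delta> = 0 then
        (SUP t\<in>{-T..T}. exp (Zp \<alpha> B \<omega> t)) / (LBINT t=-T..T. exp (Zp \<alpha> B \<omega> t))
      else
        (SUP k\<in>{k::int. \<bar>\<delta> * of_int k\<bar> \<le> T}. exp (Zp \<alpha> B \<omega> (\<delta> * of_int k))) /
        (\<delta> * (\<Sum>k\<in>{k::int. \<bar>\<delta> * of_int k\<bar> \<le> T}. exp (Zp \<alpha> B \<omega> (\<delta> * of_int k)))))"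

end

theory Submission
  imports Defs
begin

text \<open>
  Dyadic chaining bounds all exponential moments of the oscillation of \<open>B\<close> over an interval of
  length two. Combined with the Gaussian moment generating function of \<open>B m\<close>, this gives for every
  integer \<open>m\<close> a random variable \<open>U m\<close> dominating \<open>exp (Z m / 4 + l * \<bar>Z s - Z t\<bar>)\<close> for all
  \<open>s, t\<close> in \<open>[m - 1, m + 1]\<close>, with expectation at most \<open>C * exp (- \<bar>m\<bar>^\<alpha> / 16)\<close>.

  The rest is a pathwise argument. Near an almost maximiser \<open>t\<close> of \<open>Z\<close> the denominator of \<open>\<xi>\<close> is at
  least \<open>exp (Z s)\<close> for some \<open>s\<close> in the same block, while \<open>Z t \<ge> -1\<close> because \<open>Z 0 = 0\<close>; hence every
  power of \<open>\<xi>\<close> and of \<open>\<xi>(T)\<close> is dominated by \<open>\<Sum>m. U m\<close>. If the suprema over \<open>[-T, T]\<close> and over the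
  whole grid differ, then \<open>Z > 0\<close> somewhere outside \<open>[-T, T]\<close> and the tail sum \<open>V\<close> of \<open>U m\<close> over
  \<open>\<bar>m\<bar> > T - 1\<close> is at least \<open>1\<close>; otherwise only the denominators differ, by at most \<open>3 * V^4\<close>.
  In both cases the arithmetic-geometric mean inequality bounds the difference of the \<open>p\<close>-th powers
  by a multiple of \<open>(\<Sum>m. U m) / \<rho> + \<rho> * V\<close>, and \<open>\<rho> = exp (T^\<alpha> / 256)\<close> balances the two terms.
\<close>

section \<open>Exponential moments of the oscillation of fractional Brownian motion\<close>

text \<open>A dyadic point of level \<open>n + 1\<close> is either of level \<open>n\<close> or one
  increment of level \<open>n + 1\<close> away from such a point. Hence each level is used at most
  once on the way from 0, and continuity carries the bound from dyadic points to all of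
  [0, 1].\<close>

lemma dyadic_chaining:
  fixes f :: "real \<Rightarrow> real" and b :: "nat \<Rightarrow> real"
  assumes cont: "continuous_on {0..1} f"
    and b: "b sums s"
    and inc: "\<And>j i. i < 2 ^ j \<Longrightarrow> \<bar>f (real (Suc i) / 2 ^ j) - f (real i / 2 ^ j)\<bar> \<le> b j"
    and t: "t \<in> {0..1}"
  shows "\<bar>f t - f 0\<bar> \<le> s"
proof -
  have b0: "0 \<le> b j" for j
    using inc[of 0 j] by (rule order_trans[OF abs_ge_zero]) simp
  have grid: "\<bar>f (real i / 2 ^ n) - f 0\<bar> \<le> sum b {..n}" if "i \<le> 2 ^ n" for i n
    using that
  proof (induction n arbitrary: i)
    case 0
    then have "i = 0 \<or> i = 1" by auto
    then show ?case
      using inc[of 0 0] b0[of 0] by auto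
  next
    case (Suc n)
    have half: "\<bar>f (real (2 * k) / 2 ^ Suc n) - f 0\<bar> \<le> sum b {..n}" if "k \<le> 2 ^ n" for k
      using Suc.IH[OF that] by simp
    show ?case
    proof (cases "even i")
      case True
      then obtain k where k: "i = 2 * k" by blast
      then show ?thesis
        using half[of k] Suc.prems b0[of "Suc n"] by simp
    next
      case False
      then obtain k where k: "i = Suc (2 * k)" by (metis oddE Suc_eq_plus1)
      with Suc.prems have k': "2 * k < 2 ^ Suc n" "k \<le> 2 ^ n" by auto
      show ?thesis
        using half[OF k'(2)] inc[OF k'(1)] k by simp
    qed
  qed
  \<comment> \<open>\<open>x n\<close> is the largest dyadic point of level \<open>n\<close> not
    above \<open>t\<close>; approximation from below stays inside the unit interval.\<close>
  define x where "x n = real (nat \<lfloor>t * 2 ^ n\<rfloor>) / 2 ^ n" for n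
  have fl: "real (nat \<lfloor>t * 2 ^ n\<rfloor>) \<le> t * 2 ^ n" "t * 2 ^ n < real (nat \<lfloor>t * 2 ^ n\<rfloor>) + 1" for n
    using t by (auto simp: of_nat_nat)
  have x_le: "x n \<le> t" "t - (1/2) ^ n \<le> x n" for n
  proof -
    have "x n \<le> t \<and> t < (real (nat \<lfloor>t * 2 ^ n\<rfloor>) + 1) / 2 ^ n"
      unfolding x_def using fl[of n] by (simp only: divide_le_eq less_divide_eq zero_less_power zero_less_numeral if_True)
    then show "x n \<le> t" "t - (1/2) ^ n \<le> x n"
      by (auto simp: x_def add_divide_distrib power_divide)
  qed
  have x0: "0 \<le> x n" for n by (simp add: x_def)
  have "(\<lambda>n. t - (1/2) ^ n) \<longlonglongrightarrow> t - 0"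
    by (intro tendsto_intros LIMSEQ_power_zero) auto
  then have x_lim: "x \<longlonglongrightarrow> t"
    using x_le by (intro tendsto_sandwich[of "\<lambda>n. t - (1/2) ^ n" x sequentially "\<lambda>_. t"]) auto
  have "(\<lambda>n. f (x n)) \<longlonglongrightarrow> f t"
    using continuous_on_tendsto_compose[OF cont x_lim t] x_le x0 t
    by (meson atLeastAtMost_iff eventuallyI order_trans)
  then have "(\<lambda>n. \<bar>f (x n) - f 0\<bar>) \<longlonglongrightarrow> \<bar>f t - f 0\<bar>"
    by (intro tendsto_intros)
  moreover have "\<bar>f (x n) - f 0\<bar> \<le> s" for n
  proof -
    have "real (nat \<lfloor>t * 2 ^ n\<rfloor>) \<le> 2 ^ n"
      using fl(1)[of n] t by (smt (verit) atLeastAtMost_iff mult_left_le_one_le zero_less_power)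
    then have "nat \<lfloor>t * 2 ^ n\<rfloor> \<le> 2 ^ n"
      by (metis of_nat_le_iff of_nat_numeral of_nat_power)
    then have "\<bar>f (x n) - f 0\<bar> \<le> sum b {..n}"
      unfolding x_def by (rule grid)
    also have "\<dots> \<le> suminf b"
      using b b0 by (intro sum_le_suminf) (auto simp: sums_iff)
    finally show ?thesis using b by (simp add: sums_iff)
  qed
  ultimately show ?thesis
    by (intro Lim_bounded) auto
qed

text \<open>Completing the square: the tilt \<open>exp (l * x)\<close> moves the mean of the centred
  density to \<open>l * v\<close>, and what remains is a constant factor.\<close>

lemma nn_integral_exp_normal:
  assumes X: "distributed M lborel X (normal_density 0 (sqrt v))" and v: "0 < v"
  shows "(\<integral>\<^sup>+\<omega>. ennreal (exp (l * X \<omega>)) \<partial>M) = ennreal (exp (l\<^sup>2 * v / 2))"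
proof -
  have eq: "normal_density 0 (sqrt v) x * exp (l * x)
      = exp (l\<^sup>2 * v / 2) * normal_density (l * v) (sqrt v) x" for x
  proof -
    have "- x\<^sup>2 / (2 * v) + l * x = l\<^sup>2 * v / 2 + - (x - l * v)\<^sup>2 / (2 * v)"
      using v by (simp add: field_simps power2_eq_square)
    then have "exp (- x\<^sup>2 / (2 * v)) * exp (l * x) = exp (l\<^sup>2 * v / 2) * exp (- (x - l * v)\<^sup>2 / (2 * v))"
      by (metis exp_add)
    then show ?thesis
      using v by (simp add: normal_density_def)
  qed
  have "(\<integral>\<^sup>+\<omega>. ennreal (exp (l * X \<omega>)) \<partial>M)
      = (\<integral>\<^sup>+x. ennreal (normal_density 0 (sqrt v) x) * ennreal (exp (l * x)) \<partial>lborel)"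
    by (rule distributed_nn_integral[OF X, symmetric]) measurable
  also have "\<dots> = (\<integral>\<^sup>+x. ennreal (exp (l\<^sup>2 * v / 2)) * ennreal (normal_density (l * v) (sqrt v) x) \<partial>lborel)"
    by (intro nn_integral_cong) (simp add: ennreal_mult[symmetric] eq)
  also have "\<dots> = ennreal (exp (l\<^sup>2 * v / 2)) * (\<integral>\<^sup>+x. ennreal (normal_density (l * v) (sqrt v) x) \<partial>lborel)"
    by (rule nn_integral_cmult) measurable
  also have "(\<integral>\<^sup>+x. ennreal (normal_density (l * v) (sqrt v) x) \<partial>lborel) = 1"
    using v by (subst nn_integral_eq_integral) auto
  finally show ?thesis by simp
qed

section \<open>Laws of the increments of fractional Brownian motion\<close>

lemma is_fbm_D:
  assumes "is_fbm M \<alpha> B"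
  shows "prob_space M" "B t \<in> borel_measurable M"
    "\<omega> \<in> space M \<Longrightarrow> continuous_on A (\<lambda>t. B t \<omega>)"
  using assms continuous_on_subset unfolding is_fbm_def by blast+

text \<open>The variance at time 0 vanishes, so the degenerate branch of \<open>is_fbm\<close>
  applies; it gives an almost sure statement only.\<close>

lemma fbm_zero:
  assumes "is_fbm M \<alpha> B"
  shows "AE \<omega> in M. B 0 \<omega> = 0"
proof -
  have "finite {0::real}" by simp
  then show ?thesis
    using assms unfolding is_fbm_def Let_def
    by (elim conjE allE[where x="{0}"] allE[where x="\<lambda>_. 1"]) (simp add: fbm_cov_def)
qed

lemma fbm_increment_exp:
  assumes B: "is_fbm M \<alpha> B"
  shows "(\<integral>\<^sup>+\<omega>. ennreal (exp (l * (B t \<omega> - B s \<omega>))) \<partial>M) = ennreal (exp (l\<^sup>2 * \<bar>t - s\<bar> powr \<alpha> / 2))"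
\<comment> \<open>For s = t the index set collapses to a point and the increment is 0; otherwise the
  weights 1 at \<open>t\<close> and -1 at \<open>s\<close> turn the finite-dimensional law into that
  of the increment.\<close>
proof (cases "s = t")
  case True
  then show ?thesis
    using prob_space.emeasure_space_1[OF is_fbm_D(1)[OF B]] by simp
next
  case False
  define c where "c u = (if u = t then 1 else - 1 :: real)" for u
  have v: "(\<Sum>x\<in>{s,t}. \<Sum>y\<in>{s,t}. c x * c y * fbm_cov \<alpha> x y) = \<bar>t - s\<bar> powr \<alpha>"
    using False by (simp add: c_def fbm_cov_def abs_minus_commute field_simps)
  have X: "(\<Sum>x\<in>{s,t}. c x * B x \<omega>) = B t \<omega> - B s \<omega>" for \<omega>
    using False by (simp add: c_def)
  have "finite {s, t}" by simp
  then have "let X = (\<lambda>\<omega>. \<Sum>x\<in>{s,t}. c x * B x \<omega>);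
             v = (\<Sum>x\<in>{s,t}. \<Sum>y\<in>{s,t}. c x * c y * fbm_cov \<alpha> x y)
         in if v > 0 then distributed M lborel X (normal_density 0 (sqrt v))
            else (AE \<omega> in M. X \<omega> = 0)"
    using B unfolding is_fbm_def by blast
  then have "distributed M lborel (\<lambda>\<omega>. B t \<omega> - B s \<omega>) (normal_density 0 (sqrt (\<bar>t - s\<bar> powr \<alpha>)))"
    using False unfolding Let_def v X by simp
  then show ?thesis
    by (rule nn_integral_exp_normal) (use False in simp)
qed

text \<open>One of \<open>exp (l * x)\<close> and \<open>exp (- l * x)\<close> equals
  \<open>exp (l * \<bar>x\<bar>)\<close>, and both have the same expectation; this is the factor
  2.\<close>

lemma fbm_increment_exp_abs:
  assumes B: "is_fbm M \<alpha> B"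
  shows "(\<integral>\<^sup>+\<omega>. ennreal (exp (l * \<bar>B t \<omega> - B s \<omega>\<bar>)) \<partial>M) \<le> ennreal (2 * exp (l\<^sup>2 * \<bar>t - s\<bar> powr \<alpha> / 2))"
proof -
  note [measurable] = is_fbm_D(2)[OF B]
  have "(\<integral>\<^sup>+\<omega>. ennreal (exp (l * \<bar>B t \<omega> - B s \<omega>\<bar>)) \<partial>M)
      \<le> (\<integral>\<^sup>+\<omega>. ennreal (exp (l * (B t \<omega> - B s \<omega>))) + ennreal (exp (- l * (B t \<omega> - B s \<omega>))) \<partial>M)"
    by (intro nn_integral_mono)
      (auto simp: ennreal_plus[symmetric] abs_if algebra_simps simp del: ennreal_plus)
  also have "\<dots> = ennreal (exp (l\<^sup>2 * \<bar>t - s\<bar> powr \<alpha> / 2)) + ennreal (exp ((- l)\<^sup>2 * \<bar>t - s\<bar> powr \<alpha> / 2))"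
    by (subst nn_integral_add) (simp_all only: fbm_increment_exp[OF B], measurable)
  also have "\<dots> = ennreal (2 * exp (l\<^sup>2 * \<bar>t - s\<bar> powr \<alpha> / 2))"
    by (simp add: ennreal_plus[symmetric] del: ennreal_plus)
  finally show ?thesis .
qed

text \<open>The oscillation is controlled through a measurable majorant \<open>G\<close> instead of
  an uncountable supremum. \<open>K\<close> precedes \<open>M\<close>, \<open>B\<close> and
  \<open>a\<close> because the law of an increment depends on its length alone.\<close>

lemma fbm_oscillation_majorant:
  fixes \<alpha> l :: real
  assumes \<alpha>: "0 < \<alpha>" and l: "0 < l"
  shows "\<exists>K>0. \<forall>(M::'a measure) B a. is_fbm M \<alpha> B \<longrightarrow>
    (\<exists>G\<in>borel_measurable M. (\<integral>\<^sup>+\<omega>. G \<omega> \<partial>M) \<le> ennreal K \<and>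
      (\<forall>\<omega>\<in>space M. \<forall>s\<in>{a-1..a+1}. \<forall>t\<in>{a-1..a+1}.
        ennreal (exp (l * \<bar>B s \<omega> - B t \<omega>\<bar>)) \<le> G \<omega>))"
proof -
  \<comment> \<open>Halving an interval multiplies the standard deviation of the increment by
    \<open>r\<close>. The weights \<open>c j\<close> are proportional to \<open>r ^ j\<close> and
    add up to 1, so that an increment of level \<open>j\<close> divided by \<open>c j\<close> has
    the same scale on every level.\<close>
  define r where "r = (2::real) powr (- \<alpha> / 2)"
  have r: "0 < r" "r < 1"
    using \<alpha> by (auto simp: r_def powr_less_one)
  define c where "c j = (1 - r) * r ^ j" for j :: nat
  have c_pos: "0 < c j" for j using r by (simp add: c_def)
  have c_sums: "c sums 1"
    using sums_mult[OF geometric_sums[of r], of "1 - r"] r by (simp add: c_def[abs_def])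
  define D where "D = (1 - r) * ln 4 * (1 / (1 - r)\<^sup>2)"
  have cD_sums: "(\<lambda>j. c j * (real (Suc j) * ln 4)) sums D"
    using sums_mult[OF geometric_deriv_sums[of r], of "(1 - r) * ln 4"] r
    by (simp add: c_def D_def mult_ac)
  \<comment> \<open>The exponential moment of an increment of level \<open>j\<close> with parameter
    \<open>2 * l / c j\<close>, up to a factor 2: the powers of \<open>r\<close> cancel, so it does
    not depend on \<open>j\<close>.\<close>
  define K0 where "K0 = exp ((2 * l)\<^sup>2 * 2 powr \<alpha> / (2 * (1 - r)\<^sup>2))"
  have r_pow: "(2 / 2 ^ j) powr \<alpha> = 2 powr \<alpha> * (r ^ j)\<^sup>2" for j :: nat
  proof -
    have "(r ^ j)\<^sup>2 = r powr (2 * real j)"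
      using r by (simp add: powr_realpow[symmetric] powr_powr mult.commute)
    also have "\<dots> = 2 powr (- \<alpha> * real j)"
      by (simp add: r_def powr_powr field_simps)
    also have "\<dots> = (1 / 2 ^ j) powr \<alpha>"
      by (simp add: powr_realpow[symmetric] powr_powr powr_minus_divide powr_divide mult.commute)
    finally show ?thesis
      by (simp add: powr_mult[symmetric])
  qed
  show ?thesis
  proof (intro exI[of _ "exp D * K0"] conjI allI impI)
    show "0 < exp D * K0" by (simp add: K0_def)
  next
    fix M :: "'a measure" and B and a :: real
    assume B: "is_fbm M \<alpha> B"
    note [measurable] = is_fbm_D(2)[OF B]
    \<comment> \<open>The interval of length two is rescaled to [0, 1]; dyadic increments of level
      \<open>j\<close> then have length \<open>2 / 2 ^ j\<close> in the original time.\<close>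
    define f where "f \<omega> x = B (a - 1 + 2 * x) \<omega>" for \<omega> x
    have [measurable]: "(\<lambda>\<omega>. f \<omega> x) \<in> borel_measurable M" for x
      unfolding f_def by measurable
    \<comment> \<open>Every summand of \<open>R\<close> is at most \<open>R\<close>, which bounds the increments of level \<open>j\<close> by
      \<open>c j * (ln R + Suc j * ln 4) / (2 * l)\<close>. As \<open>\<Sum>j. c j = 1\<close>, these bounds add up to
      \<open>(ln R + D) / (2 * l)\<close>; the factor \<open>4 ^ - Suc j\<close> beats the \<open>2 ^ j\<close> increments of level \<open>j\<close>.\<close>
    define Y where "Y j i \<omega> = exp (2 * l / c j * \<bar>f \<omega> (real (Suc i) / 2 ^ j) - f \<omega> (real i / 2 ^ j)\<bar>) / 4 ^ Suc j"
      for j i :: nat and \<omega>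
    have Y_pos: "0 < Y j i \<omega>" for j i \<omega> by (simp add: Y_def)
    have [measurable]: "Y j i \<in> borel_measurable M" for j i
      unfolding Y_def by measurable
    define R where "R \<omega> = (\<Sum>j. \<Sum>i<2^j. ennreal (Y j i \<omega>))" for \<omega>
    have [measurable]: "R \<in> borel_measurable M"
      unfolding R_def by measurable
    have EY: "(\<integral>\<^sup>+\<omega>. ennreal (Y j i \<omega>) \<partial>M) \<le> ennreal (2 * K0 / 4 ^ Suc j)" for i j
    proof -
      have dist: "\<bar>a - 1 + 2 * (real (Suc i) / 2 ^ j) - (a - 1 + 2 * (real i / 2 ^ j))\<bar> = 2 / 2 ^ j"
        by (simp add: field_simps)
      have "(\<integral>\<^sup>+\<omega>. ennreal (Y j i \<omega>) \<partial>M)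
          = (\<integral>\<^sup>+\<omega>. ennreal (exp (2 * l / c j * \<bar>f \<omega> (real (Suc i) / 2 ^ j) - f \<omega> (real i / 2 ^ j)\<bar>)) * ennreal (1 / 4 ^ Suc j) \<partial>M)"
        by (intro nn_integral_cong) (simp add: Y_def ennreal_mult[symmetric])
      also have "\<dots> = (\<integral>\<^sup>+\<omega>. ennreal (exp (2 * l / c j * \<bar>f \<omega> (real (Suc i) / 2 ^ j) - f \<omega> (real i / 2 ^ j)\<bar>)) \<partial>M)
          * ennreal (1 / 4 ^ Suc j)"
        by (rule nn_integral_multc) measurable
      also have "\<dots> \<le> ennreal (2 * exp ((2 * l / c j)\<^sup>2 * (2 / 2 ^ j) powr \<alpha> / 2)) * ennreal (1 / 4 ^ Suc j)"
        unfolding f_def dist[symmetric] by (intro mult_right_mono fbm_increment_exp_abs[OF B]) simp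
      also have "(2 * l / c j)\<^sup>2 * (2 / 2 ^ j) powr \<alpha> / 2 = (2 * l)\<^sup>2 * 2 powr \<alpha> / (2 * (1 - r)\<^sup>2)"
        unfolding r_pow using r by (simp add: c_def power_divide power_mult_distrib)
      finally show ?thesis
        by (simp add: K0_def ennreal_mult[symmetric])
    qed
    have ER: "(\<integral>\<^sup>+\<omega>. R \<omega> \<partial>M) \<le> ennreal K0"
    proof -
      have "(\<integral>\<^sup>+\<omega>. R \<omega> \<partial>M) = (\<Sum>j. \<Sum>i<2^j. \<integral>\<^sup>+\<omega>. ennreal (Y j i \<omega>) \<partial>M)"
        unfolding R_def by (subst nn_integral_suminf) (auto simp: nn_integral_sum)
      also have "\<dots> \<le> (\<Sum>j. ennreal (K0 * (1/2) ^ Suc j))"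
      proof (intro suminf_le)
        fix j
        have "(\<Sum>i<2^j. \<integral>\<^sup>+\<omega>. ennreal (Y j i \<omega>) \<partial>M) \<le> (\<Sum>i<(2::nat)^j. ennreal (2 * K0 / 4 ^ Suc j))"
          by (intro sum_mono EY)
        also have "\<dots> = ennreal (2 ^ j * (2 * K0 / 4 ^ Suc j))"
          by (subst sum_ennreal) (auto simp: K0_def)
        also have "2 ^ j * (2 * K0 / 4 ^ Suc j) = K0 * (1/2) ^ Suc j"
          using power_mult_distrib[of "2::real" 2 j] by (simp add: field_simps)
        finally show "(\<Sum>i<2^j. \<integral>\<^sup>+\<omega>. ennreal (Y j i \<omega>) \<partial>M) \<le> ennreal (K0 * (1/2) ^ Suc j)" .
      qed auto
      also have "\<dots> = ennreal K0"
        using sums_mult[OF power_half_series, of K0]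
        by (intro suminf_ennreal_eq) (auto simp: K0_def)
      finally show ?thesis .
    qed
    have bound: "ennreal (exp (l * \<bar>B s \<omega> - B t \<omega>\<bar>)) \<le> ennreal (exp D) * R \<omega>"
      if \<omega>: "\<omega> \<in> space M" and s: "s \<in> {a-1..a+1}" and t: "t \<in> {a-1..a+1}" for s t \<omega>
    \<comment> \<open>\<open>R\<close> may be infinite on a null set. There the bound is trivial, so
      the majorant works at every point of the space.\<close>
    proof (cases "R \<omega> = \<infinity>")
      case True
      then show ?thesis by (simp add: ennreal_mult_top)
    next
      case False
      then obtain R' where R': "R \<omega> = ennreal R'" "0 \<le> R'"
        by (cases "R \<omega>") auto
      have Y_le: "Y j i \<omega> \<le> R'" if "i < 2 ^ j" for i j
      proof -
        have "ennreal (Y j i \<omega>) \<le> (\<Sum>i<2^j. ennreal (Y j i \<omega>))"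
          using that by (intro member_le_sum) auto
        also have "\<dots> \<le> R \<omega>"
          unfolding R_def using sum_le_suminf[of "\<lambda>j. \<Sum>i<2^j. ennreal (Y j i \<omega>)" "{j}"] by simp
        finally show ?thesis using R' by simp
      qed
      have R'_pos: "0 < R'"
        using Y_le[of 0 0] Y_pos[of 0 0 \<omega>] by simp
      define b where "b j = (c j * ln R' + c j * (real (Suc j) * ln 4)) / (2 * l)" for j
      have b_sums: "b sums ((1 * ln R' + D) / (2 * l))"
        unfolding b_def by (intro sums_divide sums_add sums_mult2 c_sums cD_sums)
      have inc: "\<bar>f \<omega> (real (Suc i) / 2 ^ j) - f \<omega> (real i / 2 ^ j)\<bar> \<le> b j" if "i < 2 ^ j" for i j
      proof -
        let ?x = "\<bar>f \<omega> (real (Suc i) / 2 ^ j) - f \<omega> (real i / 2 ^ j)\<bar>"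
        have "exp (2 * l / c j * ?x) \<le> R' * 4 ^ Suc j"
          using Y_le[OF that] by (simp add: Y_def divide_le_eq)
        then have "2 * l / c j * ?x \<le> ln (R' * 4 ^ Suc j)"
          using R'_pos by (simp add: ln_ge_iff)
        also have "\<dots> = ln R' + real (Suc j) * ln 4"
          using R'_pos by (simp only: ln_mult_pos ln_realpow zero_less_power zero_less_numeral)
        finally show ?thesis
          unfolding b_def using c_pos[of j] l by (simp add: field_simps)
      qed
      have cont: "continuous_on {0..1} (f \<omega>)"
        unfolding f_def
        by (rule continuous_on_compose2[OF is_fbm_D(3)[OF B \<omega>, of UNIV]]) (auto intro!: continuous_intros)
      have dev: "\<bar>B u \<omega> - f \<omega> 0\<bar> \<le> (ln R' + D) / (2 * l)" if "u \<in> {a-1..a+1}" for u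
      proof -
        have "\<bar>f \<omega> ((u - a + 1) / 2) - f \<omega> 0\<bar> \<le> (1 * ln R' + D) / (2 * l)"
          by (rule dyadic_chaining[OF cont b_sums inc]) (use that in auto)
        then show ?thesis by (simp add: f_def field_simps)
      qed
      \<comment> \<open>This is why \<open>Y\<close> carries \<open>2 * l\<close> and not
        \<open>l\<close>: the two points are compared through the left end point, which costs two
        deviations.\<close>
      have "l * \<bar>B s \<omega> - B t \<omega>\<bar> \<le> l * ((ln R' + D) / (2 * l) + (ln R' + D) / (2 * l))"
        using dev[OF s] dev[OF t] l by (intro mult_left_mono) auto
      also have "\<dots> = D + ln R'" using l by (simp add: field_simps)
      finally have "exp (l * \<bar>B s \<omega> - B t \<omega>\<bar>) \<le> exp D * R'"
        using R'_pos by (metis exp_add exp_le_cancel_iff exp_ln)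
      then show ?thesis
        using R' by (simp add: ennreal_mult[symmetric])
    qed
    show "\<exists>G\<in>borel_measurable M. (\<integral>\<^sup>+\<omega>. G \<omega> \<partial>M) \<le> ennreal (exp D * K0) \<and>
      (\<forall>\<omega>\<in>space M. \<forall>s\<in>{a-1..a+1}. \<forall>t\<in>{a-1..a+1}.
        ennreal (exp (l * \<bar>B s \<omega> - B t \<omega>\<bar>)) \<le> G \<omega>)"
    proof (intro bexI[of _ "\<lambda>\<omega>. ennreal (exp D) * R \<omega>"] conjI ballI bound)
      show "(\<integral>\<^sup>+\<omega>. ennreal (exp D) * R \<omega> \<partial>M) \<le> ennreal (exp D * K0)"
        using ER by (simp add: nn_integral_cmult ennreal_mult K0_def mult_left_mono)
    qed auto
  qed
qed

section \<open>Oscillation of the drift\<close>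

lemma powr_subadditive:
  fixes a b \<beta> :: real
  assumes "0 \<le> a" "0 \<le> b" "0 < \<beta>" "\<beta> \<le> 1"
  shows "(a + b) powr \<beta> \<le> a powr \<beta> + b powr \<beta>"
proof (cases "a = 0 \<or> b = 0")
  case False
  then have pos: "0 < a" "0 < b" using assms by auto
  have split: "x powr \<beta> = x * x powr (\<beta> - 1)" if "0 < x" for x :: real
    using that by (simp add: powr_mult_base)
  \<comment> \<open>One factor of the base is split off because the remaining exponent \<beta> - 1
    is not positive: replacing a + b by the smaller a or b can only increase that power.\<close>
  have "(a + b) powr \<beta> = a * (a + b) powr (\<beta> - 1) + b * (a + b) powr (\<beta> - 1)"
    using pos split[of "a + b"] by (simp add: distrib_right)
  also have "\<dots> \<le> a * a powr (\<beta> - 1) + b * b powr (\<beta> - 1)"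
    using pos assms by (intro add_mono mult_left_mono powr_mono2') auto
  also have "\<dots> = a powr \<beta> + b powr \<beta>"
    using pos split by simp
  finally show ?thesis .
qed (use assms in auto)

lemma powr_diff_le_powr_dist:
  fixes u v \<beta> :: real
  assumes "0 \<le> u" "0 \<le> v" "0 < \<beta>" "\<beta> \<le> 1"
  shows "\<bar>u powr \<beta> - v powr \<beta>\<bar> \<le> \<bar>u - v\<bar> powr \<beta>"
proof (cases "u \<le> v")
  case True
  then show ?thesis
    using powr_subadditive[of u "v - u" \<beta>] powr_mono2[of \<beta> u v] assms by simp
next
  case False
  then show ?thesis
    using powr_subadditive[of v "u - v" \<beta>] powr_mono2[of \<beta> v u] assms by simp
qed

text \<open>Since \<alpha> may exceed 1, the drift is written as the square of
  \<open>\<bar>t\<bar> powr (\<alpha>/2)\<close>, whose exponent is below 1. The difference of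
  squares has one factor at most 2 and one of order \<open>\<bar>x\<bar> powr (\<alpha>/2)\<close>,
  so the oscillation is only of the order of the square root of the drift.\<close>

lemma drift_oscillation:
  fixes \<alpha> x s t :: real
  assumes \<alpha>: "0 < \<alpha>" "\<alpha> < 2" and s: "s \<in> {x-1..x+1}" and t: "t \<in> {x-1..x+1}"
  shows "\<bar>\<bar>s\<bar> powr \<alpha> - \<bar>t\<bar> powr \<alpha>\<bar> \<le> 4 * (\<bar>x\<bar> powr (\<alpha>/2) + 1)"
proof -
  have sq: "w powr \<alpha> = w powr (\<alpha>/2) * w powr (\<alpha>/2)" for w :: real
    by (simp add: powr_add[symmetric])
  have le: "\<bar>w\<bar> powr (\<alpha>/2) \<le> \<bar>x\<bar> powr (\<alpha>/2) + 1" if "w \<in> {x-1..x+1}" for w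
  proof -
    have "\<bar>w\<bar> powr (\<alpha>/2) \<le> (\<bar>x\<bar> + 1) powr (\<alpha>/2)"
      using that \<alpha> by (intro powr_mono2) auto
    also have "\<dots> \<le> \<bar>x\<bar> powr (\<alpha>/2) + 1"
      using powr_subadditive[of "\<bar>x\<bar>" 1 "\<alpha>/2"] \<alpha> by simp
    finally show ?thesis .
  qed
  have "\<bar>\<bar>s\<bar> powr (\<alpha>/2) - \<bar>t\<bar> powr (\<alpha>/2)\<bar> \<le> \<bar>\<bar>s\<bar> - \<bar>t\<bar>\<bar> powr (\<alpha>/2)"
    using \<alpha> by (intro powr_diff_le_powr_dist) auto
  also have "\<dots> \<le> 2 powr (\<alpha>/2)"
    using \<alpha> s t by (intro powr_mono2) auto
  also have "\<dots> \<le> 2 powr 1"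
    using \<alpha> by (intro powr_mono) auto
  finally have d: "\<bar>\<bar>s\<bar> powr (\<alpha>/2) - \<bar>t\<bar> powr (\<alpha>/2)\<bar> \<le> 2" by simp
  have "\<bar>\<bar>s\<bar> powr \<alpha> - \<bar>t\<bar> powr \<alpha>\<bar>
      = \<bar>\<bar>s\<bar> powr (\<alpha>/2) - \<bar>t\<bar> powr (\<alpha>/2)\<bar> * (\<bar>s\<bar> powr (\<alpha>/2) + \<bar>t\<bar> powr (\<alpha>/2))"
  proof -
    have "\<bar>s\<bar> powr \<alpha> - \<bar>t\<bar> powr \<alpha>
      = (\<bar>s\<bar> powr (\<alpha>/2) - \<bar>t\<bar> powr (\<alpha>/2)) * (\<bar>s\<bar> powr (\<alpha>/2) + \<bar>t\<bar> powr (\<alpha>/2))"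
      unfolding sq by (simp add: algebra_simps)
    then show ?thesis by (simp add: abs_mult)
  qed
  also have "\<dots> \<le> 2 * (2 * (\<bar>x\<bar> powr (\<alpha>/2) + 1))"
    using le[OF s] le[OF t] by (intro mult_mono d) auto
  finally show ?thesis by simp
qed

text \<open>The value at the centre and the oscillation are dependent, so they are separated by exp
  (a + c) \<le> exp (2 a) + exp (2 c). With \<open>y = \<bar>x\<bar> powr (\<alpha>/2)\<close>, the
  expectation of \<open>exp (Z x / 2)\<close> is \<open>exp (- y^2 / 4)\<close>; shifting
  \<open>y^2 / 16\<close> from c to a hands half of this decay to the oscillation term, where it
  beats the linear term from the drift.\<close>

lemma fbm_block_majorant:
  fixes \<alpha> l :: real
  assumes \<alpha>: "0 < \<alpha>" "\<alpha> < 2" and l: "0 < l"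
  shows "\<exists>C>0. \<forall>(M::'a measure) B x. is_fbm M \<alpha> B \<longrightarrow>
    (\<exists>U\<in>borel_measurable M. (\<integral>\<^sup>+\<omega>. U \<omega> \<partial>M) \<le> ennreal (C * exp (- (\<bar>x\<bar> powr \<alpha>) / 16)) \<and>
      (\<forall>\<omega>\<in>space M. \<forall>s\<in>{x-1..x+1}. \<forall>t\<in>{x-1..x+1}.
        ennreal (exp (Zp \<alpha> B \<omega> x / 4 + l * \<bar>Zp \<alpha> B \<omega> s - Zp \<alpha> B \<omega> t\<bar>)) \<le> U \<omega>))"
proof -
  \<comment> \<open>The parameter \<open>2 * sqrt 2 * l\<close> collects the 2 from the separation
    of the two exponentials and the \<open>sqrt 2\<close> in front of \<open>B\<close>.\<close>
  obtain K where K: "0 < K" and Kprop: "\<And>(M::'a measure) B a. is_fbm M \<alpha> B \<Longrightarrow>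
    (\<exists>G\<in>borel_measurable M. (\<integral>\<^sup>+\<omega>. G \<omega> \<partial>M) \<le> ennreal K \<and>
      (\<forall>\<omega>\<in>space M. \<forall>s\<in>{a-1..a+1}. \<forall>t\<in>{a-1..a+1}.
        ennreal (exp ((2 * sqrt 2 * l) * \<bar>B s \<omega> - B t \<omega>\<bar>)) \<le> G \<omega>))"
    using fbm_oscillation_majorant[OF \<alpha>(1), of "2 * sqrt 2 * l", where ?'a='a] l by auto
  define C where "C = 1 + K * exp (256 * l\<^sup>2 + 8 * l)"
  show ?thesis
  proof (intro exI[of _ C] conjI allI impI)
    show "0 < C" using K by (simp add: C_def add_pos_pos)
  next
    fix M :: "'a measure" and B and x :: real
    assume B: "is_fbm M \<alpha> B"
    note [measurable] = is_fbm_D(2)[OF B]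
    have [measurable]: "(\<lambda>\<omega>. Zp \<alpha> B \<omega> t) \<in> borel_measurable M" for t
      unfolding Zp_def by measurable
    obtain G where [measurable]: "G \<in> borel_measurable M" and EG: "(\<integral>\<^sup>+\<omega>. G \<omega> \<partial>M) \<le> ennreal K"
      and G: "\<And>\<omega> s t. \<omega> \<in> space M \<Longrightarrow> s \<in> {x-1..x+1} \<Longrightarrow> t \<in> {x-1..x+1} \<Longrightarrow>
        ennreal (exp ((2 * sqrt 2 * l) * \<bar>B s \<omega> - B t \<omega>\<bar>)) \<le> G \<omega>"
      using Kprop[OF B, of x] by auto
    define y where "y = \<bar>x\<bar> powr (\<alpha>/2)"
    have y2: "\<bar>x\<bar> powr \<alpha> = y\<^sup>2"
      by (simp add: y_def power2_eq_square powr_add[symmetric])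
    define U where "U \<omega> = ennreal (exp (y\<^sup>2 / 8 + Zp \<alpha> B \<omega> x / 2))
        + ennreal (exp (8 * l * (y + 1) - y\<^sup>2 / 8)) * G \<omega>" for \<omega>
    have Um: "U \<in> borel_measurable M" unfolding U_def by measurable
    have "(\<integral>\<^sup>+\<omega>. ennreal (exp (y\<^sup>2 / 8 + Zp \<alpha> B \<omega> x / 2)) \<partial>M)
        = (\<integral>\<^sup>+\<omega>. ennreal (exp (- 3 / 8 * y\<^sup>2)) * ennreal (exp (sqrt 2 / 2 * (B x \<omega> - B 0 \<omega>))) \<partial>M)"
    \<comment> \<open>The exponential moment is available for increments, so \<open>B 0\<close>,
      which vanishes almost surely, is subtracted.\<close>
    proof (rule nn_integral_cong_AE, use fbm_zero[OF B] in eventually_elim)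
      case (elim \<omega>)
      have "y\<^sup>2 / 8 + Zp \<alpha> B \<omega> x / 2 = - 3 / 8 * y\<^sup>2 + sqrt 2 / 2 * (B x \<omega> - B 0 \<omega>)"
        unfolding Zp_def y2 elim by (simp add: field_simps)
      then show ?case by (simp add: ennreal_mult[symmetric] exp_add[symmetric])
    qed
    also have "\<dots> = ennreal (exp (- 3 / 8 * y\<^sup>2)) * ennreal (exp ((sqrt 2 / 2)\<^sup>2 * \<bar>x - 0\<bar> powr \<alpha> / 2))"
      by (subst nn_integral_cmult) (simp_all only: fbm_increment_exp[OF B], measurable)
    also have "\<dots> = ennreal (exp (- y\<^sup>2 / 8))"
      by (simp add: y2 power_divide ennreal_mult[symmetric] exp_add[symmetric])
    finally have first: "(\<integral>\<^sup>+\<omega>. ennreal (exp (y\<^sup>2 / 8 + Zp \<alpha> B \<omega> x / 2)) \<partial>M) = ennreal (exp (- y\<^sup>2 / 8))" .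
    have "(\<integral>\<^sup>+\<omega>. U \<omega> \<partial>M) = ennreal (exp (- y\<^sup>2 / 8)) + ennreal (exp (8 * l * (y + 1) - y\<^sup>2 / 8)) * (\<integral>\<^sup>+\<omega>. G \<omega> \<partial>M)"
      unfolding U_def by (subst nn_integral_add) (simp_all add: first nn_integral_cmult)
    also have "\<dots> \<le> ennreal (exp (- y\<^sup>2 / 8)) + ennreal (exp (8 * l * (y + 1) - y\<^sup>2 / 8)) * ennreal K"
      by (intro add_left_mono mult_left_mono EG) simp
    also have "\<dots> = ennreal (exp (- y\<^sup>2 / 8) + exp (8 * l * (y + 1) - y\<^sup>2 / 8) * K)"
      using K by (simp add: ennreal_mult[symmetric] ennreal_plus[symmetric] del: ennreal_plus)
    also have "\<dots> \<le> ennreal (C * exp (- y\<^sup>2 / 16))"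
    proof (rule ennreal_leI)
      \<comment> \<open>The square bounds the linear term \<open>8 * l * y\<close> by half of the
        decay \<open>y^2 / 8\<close> plus the constant \<open>256 * l^2\<close> that appears in
        \<open>C\<close>.\<close>
      have "0 \<le> (y / 4 - 16 * l)\<^sup>2" by simp
      then have "8 * l * (y + 1) - y\<^sup>2 / 8 \<le> (256 * l\<^sup>2 + 8 * l) + - y\<^sup>2 / 16"
        by (simp add: power2_eq_square algebra_simps)
      then have "exp (8 * l * (y + 1) - y\<^sup>2 / 8) \<le> exp (256 * l\<^sup>2 + 8 * l) * exp (- y\<^sup>2 / 16)"
        by (simp add: exp_add[symmetric])
      then have "exp (8 * l * (y + 1) - y\<^sup>2 / 8) * K \<le> exp (256 * l\<^sup>2 + 8 * l) * exp (- y\<^sup>2 / 16) * K"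
        using K by simp
      from add_mono[OF _ this, of "exp (- y\<^sup>2 / 8)" "exp (- y\<^sup>2 / 16)"]
      show "exp (- y\<^sup>2 / 8) + exp (8 * l * (y + 1) - y\<^sup>2 / 8) * K \<le> C * exp (- y\<^sup>2 / 16)"
        by (simp add: C_def algebra_simps)
    qed
    finally have EU: "(\<integral>\<^sup>+\<omega>. U \<omega> \<partial>M) \<le> ennreal (C * exp (- (\<bar>x\<bar> powr \<alpha>) / 16))" by (simp add: y2)
    have dom: "ennreal (exp (Zp \<alpha> B \<omega> x / 4 + l * \<bar>Zp \<alpha> B \<omega> s - Zp \<alpha> B \<omega> t\<bar>)) \<le> U \<omega>"
      if \<omega>: "\<omega> \<in> space M" and s: "s \<in> {x-1..x+1}" and t: "t \<in> {x-1..x+1}" for \<omega> s t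
    proof -
      let ?b = "\<bar>Zp \<alpha> B \<omega> s - Zp \<alpha> B \<omega> t\<bar>"
      have "?b \<le> sqrt 2 * \<bar>B s \<omega> - B t \<omega>\<bar> + \<bar>\<bar>s\<bar> powr \<alpha> - \<bar>t\<bar> powr \<alpha>\<bar>"
      proof -
        have "?b = \<bar>sqrt 2 * (B s \<omega> - B t \<omega>) - (\<bar>s\<bar> powr \<alpha> - \<bar>t\<bar> powr \<alpha>)\<bar>"
          unfolding Zp_def by (simp add: algebra_simps)
        also have "\<dots> \<le> \<bar>sqrt 2 * (B s \<omega> - B t \<omega>)\<bar> + \<bar>\<bar>s\<bar> powr \<alpha> - \<bar>t\<bar> powr \<alpha>\<bar>"
          by (rule abs_triangle_ineq4)
        finally show ?thesis by (simp add: abs_mult)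
      qed
      also have "\<dots> \<le> sqrt 2 * \<bar>B s \<omega> - B t \<omega>\<bar> + 4 * (y + 1)"
        unfolding y_def by (intro add_left_mono drift_oscillation[OF \<alpha> s t])
      finally have "2 * l * ?b \<le> 2 * l * (sqrt 2 * \<bar>B s \<omega> - B t \<omega>\<bar> + 4 * (y + 1))"
        using l by (intro mult_left_mono) auto
      then have b: "2 * l * ?b \<le> (2 * sqrt 2 * l) * \<bar>B s \<omega> - B t \<omega>\<bar> + 8 * l * (y + 1)"
        by (simp add: algebra_simps)
      have amgm: "exp (a + c) \<le> exp (2 * a) + exp (2 * c)" for a c :: real
      proof -
        have "0 < exp a * exp c" by simp
        then show ?thesis
          using sum_squares_bound[of "exp a" "exp c"] unfolding exp_add exp_double by linarith
      qed
      have "exp (Zp \<alpha> B \<omega> x / 4 + l * ?b) = exp ((Zp \<alpha> B \<omega> x / 4 + y\<^sup>2/16) + (l * ?b - y\<^sup>2/16))"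
        by simp
      also have "\<dots> \<le> exp (2 * (Zp \<alpha> B \<omega> x / 4 + y\<^sup>2/16)) + exp (2 * (l * ?b - y\<^sup>2/16))"
        by (rule amgm)
      also have "2 * (Zp \<alpha> B \<omega> x / 4 + y\<^sup>2/16) = y\<^sup>2 / 8 + Zp \<alpha> B \<omega> x / 2" by simp
      also have "exp (2 * (l * ?b - y\<^sup>2/16)) \<le> exp (8 * l * (y + 1) - y\<^sup>2 / 8) * exp ((2 * sqrt 2 * l) * \<bar>B s \<omega> - B t \<omega>\<bar>)"
        using b by (simp add: exp_add[symmetric] algebra_simps)
      finally have "ennreal (exp (Zp \<alpha> B \<omega> x / 4 + l * ?b)) \<le> ennreal (exp (y\<^sup>2 / 8 + Zp \<alpha> B \<omega> x / 2))
          + ennreal (exp (8 * l * (y + 1) - y\<^sup>2 / 8)) * ennreal (exp ((2 * sqrt 2 * l) * \<bar>B s \<omega> - B t \<omega>\<bar>))"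
        by (simp add: ennreal_mult[symmetric] ennreal_plus[symmetric] del: ennreal_plus)
      also have "\<dots> \<le> U \<omega>"
        unfolding U_def by (intro add_left_mono mult_left_mono G \<omega> s t) simp
      finally show ?thesis .
    qed
    show "\<exists>U\<in>borel_measurable M. (\<integral>\<^sup>+\<omega>. U \<omega> \<partial>M) \<le> ennreal (C * exp (- (\<bar>x\<bar> powr \<alpha>) / 16)) \<and>
      (\<forall>\<omega>\<in>space M. \<forall>s\<in>{x-1..x+1}. \<forall>t\<in>{x-1..x+1}.
        ennreal (exp (Zp \<alpha> B \<omega> x / 4 + l * \<bar>Zp \<alpha> B \<omega> s - Zp \<alpha> B \<omega> t\<bar>)) \<le> U \<omega>)"
      using Um EU dom by blast
  qed
qed

section \<open>Pathwise bounds for the ratio\<close>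

definition block :: "int \<Rightarrow> real set" where
  "block m = {of_int m - 1..of_int m + 1}"

text \<open>Rounding towards 0. The unit interval that starts at \<open>t\<close> and points towards
  0 then lies in a single block, and it does not leave [-T, T] when t is in [-T, T] and T \<ge>
  1.\<close>

definition block_index :: "real \<Rightarrow> int" where
  "block_index t = (if 0 \<le> t then \<lfloor>t\<rfloor> else \<lceil>t\<rceil>)"

lemma block_index_mem: "t \<in> block (block_index t)"
  and block_index_abs: "\<bar>t\<bar> < \<bar>of_int (block_index t)\<bar> + 1"
  and block_index_left: "0 \<le> t \<Longrightarrow> {t-1..t} \<subseteq> block (block_index t)"
  and block_index_right: "t < 0 \<Longrightarrow> {t..t+1} \<subseteq> block (block_index t)"
  unfolding block_def block_index_def by (auto; linarith)+

text \<open>With x = (b - a) / a the left side is at most p x, hence at most p x^(1/8) for x \<le>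
  1; for larger x the right side exceeds 1. The exponent 1/8 becomes 1/4 after squaring, matching
  the bound of the missing mass by a fourth power.\<close>

lemma one_minus_powr_bound:
  fixes a b p :: real
  assumes "0 < a" "a \<le> b" "0 < p"
  shows "1 - (a / b) powr p \<le> (1 + p) * ((b - a) / a) powr (1/8)"
proof (cases "b - a \<le> a")
  case True
  define x where "x = (b - a) / a"
  have x: "0 \<le> x" "x \<le> 1" using assms True by (auto simp: x_def)
  have ab: "a / b = 1 / (1 + x)" using assms by (simp add: x_def field_simps)
  have "1 - p * x \<le> 1 + - (p * ln (1 + x))"
    using ln_add_one_self_le_self[OF x(1)] assms by simp
  also have "\<dots> \<le> exp (- (p * ln (1 + x)))" by (rule exp_ge_add_one_self)
  also have "\<dots> = (a / b) powr p"
    unfolding ab using x by (simp add: powr_def ln_div)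
  finally have "1 - (a / b) powr p \<le> p * x" by simp
  also have "\<dots> \<le> p * x powr (1/8)"
    using x assms powr_mono'[of "1/8" 1 x] by (intro mult_left_mono) auto
  also have "\<dots> \<le> (1 + p) * x powr (1/8)" by (intro mult_right_mono) auto
  finally show ?thesis by (simp add: x_def)
next
  case False
  then have "1 \<le> ((b - a) / a) powr (1/8)"
    using assms by (intro ge_one_powr_ge_zero) auto
  then have "1 * 1 \<le> (1 + p) * ((b - a) / a) powr (1/8)"
    using assms by (intro mult_mono) auto
  then show ?thesis by (smt (verit) powr_ge_zero)
qed

text \<open>
  The measure \<open>\<nu>\<close> is \<open>\<delta>\<close> times counting measure on \<open>D = \<delta>\<int>\<close>, or Lebesgue measure on \<open>D = \<real>\<close>
  when \<open>\<delta> = 0\<close>; \<open>S X / I X\<close> is \<open>\<xi>\<close> for \<open>X = UNIV\<close> and \<open>\<xi>(T)\<close> for \<open>X = {-T..T}\<close>.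
\<close>

locale block_ratio =
  fixes z :: "real \<Rightarrow> real" and D :: "real set" and \<nu> :: "real measure"
    and u :: "int \<Rightarrow> ennreal" and l :: real
  assumes cont: "continuous_on UNIV z" and z0: "z 0 = 0" and D0: "0 \<in> D"
    and sets_\<nu> [measurable_cong]: "sets \<nu> = sets borel"
    and mass_left: "\<And>t. t \<in> D \<Longrightarrow> 1 \<le> emeasure \<nu> {t-1..t}"
    and mass_right: "\<And>t. t \<in> D \<Longrightarrow> 1 \<le> emeasure \<nu> {t..t+1}"
    and mass_block: "\<And>m. emeasure \<nu> (block m) \<le> 3"
    and u_ge: "\<And>m s t. s \<in> block m \<Longrightarrow> t \<in> block m \<Longrightarrow>
      ennreal (exp (z (of_int m) / 4 + l * \<bar>z s - z t\<bar>)) \<le> u m"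
    and u_finite: "(\<integral>\<^sup>+m. u m \<partial>count_space UNIV) < \<infinity>"
    and l_ge: "1 / 4 \<le> l"
begin

text \<open>Serves for the sum over all blocks as well as for its tail; \<open>u_finite\<close>
  ensures that the conversion to a real number loses nothing.\<close>

definition W :: "int set \<Rightarrow> real" where
  "W N = enn2real (\<integral>\<^sup>+m. u m * indicator N m \<partial>count_space UNIV)"

definition S :: "real set \<Rightarrow> real" where
  "S X = (SUP t\<in>D \<inter> X. exp (z t))"

definition I :: "real set \<Rightarrow> real" where
  "I X = (\<integral>t\<in>X. exp (z t) \<partial>\<nu>)"

lemma z_measurable [measurable]: "z \<in> borel_measurable borel"
  using cont by (rule borel_measurable_continuous_onI)

lemma ennreal_W: "ennreal (W N) = (\<integral>\<^sup>+m. u m * indicator N m \<partial>count_space UNIV)"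
proof -
  have "(\<integral>\<^sup>+m. u m * indicator N m \<partial>count_space UNIV) \<le> (\<integral>\<^sup>+m. u m \<partial>count_space UNIV)"
    by (intro nn_integral_mono) (auto split: split_indicator)
  then show ?thesis
    unfolding W_def using u_finite by (intro ennreal_enn2real) (auto simp: less_top)
qed

lemma W_nonneg: "0 \<le> W N"
  by (simp add: W_def)

lemma u_le_W: "m \<in> N \<Longrightarrow> u m \<le> ennreal (W N)"
  unfolding ennreal_W using nn_integral_ge_point[of m UNIV "\<lambda>m. u m * indicator N m"] by simp

text \<open>Moving from the centre of the block to \<open>t\<close> changes \<open>z / 4\<close> by
  at most a quarter of the oscillation, which \<open>l_ge\<close> leaves room for.\<close>

lemma exp_quarter_le_u:
  assumes "t \<in> block m" shows "ennreal (exp (z t / 4)) \<le> u m"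
proof -
  have "z t / 4 \<le> z (of_int m) / 4 + 1/4 * \<bar>z t - z (of_int m)\<bar>" by (simp add: abs_if)
  also have "\<dots> \<le> z (of_int m) / 4 + l * \<bar>z t - z (of_int m)\<bar>"
    using l_ge by (intro add_left_mono mult_right_mono) auto
  finally have "ennreal (exp (z t / 4)) \<le> ennreal (exp (z (of_int m) / 4 + l * \<bar>z t - z (of_int m)\<bar>))"
    by (intro ennreal_leI) simp
  also have "\<dots> \<le> u m"
    by (rule u_ge[OF assms]) (simp add: block_def)
  finally show ?thesis .
qed

lemma exp_quarter_le_W:
  assumes "t \<in> block m" "m \<in> N" shows "exp (z t / 4) \<le> W N"
  using order_trans[OF exp_quarter_le_u[OF assms(1)] u_le_W[OF assms(2)]] W_nonneg by simp

text \<open>The expectation of exp (Z t) is 1 for every t and does not decay, so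
  \<open>exp z\<close> is treated as the fourth power of \<open>exp (z / 4)\<close>: three factors
  are bounded by \<open>W N\<close>, and the last one is summed over the blocks, each of mass at
  most 3.\<close>

lemma nn_integral_exp_le:
  assumes [measurable]: "X \<in> sets borel" and X: "\<And>t. t \<in> X \<Longrightarrow> block_index t \<in> N"
  shows "(\<integral>\<^sup>+t. ennreal (exp (z t) * indicator X t) \<partial>\<nu>) \<le> ennreal (3 * W N ^ 4)"
proof -
  have [measurable]: "block m \<in> sets borel" for m by (simp add: block_def)
  define f where "f m t = ennreal (W N ^ 3) * (u m * indicator N m) * indicator (block m) t" for m t
  have "(\<integral>\<^sup>+t. ennreal (exp (z t) * indicator X t) \<partial>\<nu>) \<le> (\<integral>\<^sup>+t. \<integral>\<^sup>+m. f m t \<partial>count_space UNIV \<partial>\<nu>)"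
  proof (intro nn_integral_mono)
    fix t
    show "ennreal (exp (z t) * indicator X t) \<le> (\<integral>\<^sup>+m. f m t \<partial>count_space UNIV)"
    proof (cases "t \<in> X")
      case True
      define m where "m = block_index t"
      have m: "m \<in> N" "t \<in> block m"
        using X[OF True] block_index_mem by (auto simp: m_def)
      have "exp (z t) = exp (z t / 4) ^ 4"
        by (simp add: exp_of_nat_mult[symmetric])
      also have "\<dots> = exp (z t / 4) ^ 3 * exp (z t / 4)"
        by (simp add: power_Suc[symmetric] numeral_eq_Suc mult_ac)
      also have "\<dots> \<le> W N ^ 3 * exp (z t / 4)"
        using exp_quarter_le_W[OF m(2,1)] by (intro mult_right_mono power_mono) auto
      finally have "ennreal (exp (z t)) \<le> ennreal (W N ^ 3) * ennreal (exp (z t / 4))"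
        using W_nonneg by (simp add: ennreal_mult[symmetric])
      also have "\<dots> \<le> ennreal (W N ^ 3) * u m"
        by (intro mult_left_mono exp_quarter_le_u m) simp
      also have "\<dots> = f m t" using m by (simp add: f_def)
      also have "\<dots> \<le> (\<integral>\<^sup>+m. f m t \<partial>count_space UNIV)"
        by (rule nn_integral_ge_point) simp
      finally show ?thesis using True by simp
    qed simp
  qed
  also have "\<dots> = (\<integral>\<^sup>+m. \<integral>\<^sup>+t. f m t \<partial>\<nu> \<partial>count_space UNIV)"
    unfolding f_def by (intro nn_integral_count_space_nn_integral) auto
  also have "\<dots> = (\<integral>\<^sup>+m. ennreal (W N ^ 3) * (u m * indicator N m) * emeasure \<nu> (block m) \<partial>count_space UNIV)"
    unfolding f_def by (intro nn_integral_cong nn_integral_cmult_indicator) (simp add: sets_\<nu>)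
  also have "\<dots> \<le> (\<integral>\<^sup>+m. ennreal (W N ^ 3) * (u m * indicator N m) * 3 \<partial>count_space UNIV)"
    by (intro nn_integral_mono mult_left_mono mass_block) simp
  also have "\<dots> = ennreal (W N ^ 3) * ennreal (W N) * 3"
    by (simp add: nn_integral_multc nn_integral_cmult ennreal_W)
  also have "\<dots> = ennreal (3 * W N ^ 4)"
    using W_nonneg by (simp add: ennreal_mult[symmetric] ennreal_numeral[symmetric] power_Suc[symmetric]
        numeral_eq_Suc mult_ac del: ennreal_numeral)
  finally show ?thesis .
qed

lemma integrable_exp:
  assumes "X \<in> sets borel" shows "set_integrable \<nu> X (\<lambda>t. exp (z t))"
  unfolding set_integrable_def
proof (rule integrableI_nonneg)
  have "(\<integral>\<^sup>+t. ennreal (indicat_real X t *\<^sub>R exp (z t)) \<partial>\<nu>) \<le> ennreal (3 * W UNIV ^ 4)"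
    using nn_integral_exp_le[OF assms, of UNIV] by (simp add: mult.commute)
  then show "(\<integral>\<^sup>+t. ennreal (indicat_real X t *\<^sub>R exp (z t)) \<partial>\<nu>) < \<infinity>"
    by (auto intro: le_less_trans)
qed (use assms in auto)

lemma ennreal_I:
  assumes "X \<in> sets borel"
  shows "ennreal (I X) = (\<integral>\<^sup>+t. ennreal (exp (z t) * indicator X t) \<partial>\<nu>)"
  unfolding I_def set_lebesgue_integral_def
  by (subst nn_integral_eq_integral[symmetric])
    (use integrable_exp[OF assms] in \<open>auto simp: set_integrable_def mult.commute\<close>)

text \<open>Makes the suprema in \<open>S\<close> genuine; for an unbounded set of reals
  \<open>SUP\<close> would be an unspecified value.\<close>

lemma bdd_exp: "bdd_above ((\<lambda>t. exp (z t)) ` X)"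
proof (rule bdd_aboveI2)
  fix t
  have "exp (z t / 4) ^ 4 \<le> W UNIV ^ 4"
    by (intro power_mono exp_quarter_le_W[OF block_index_mem]) auto
  then show "exp (z t) \<le> W UNIV ^ 4"
    by (simp add: exp_of_nat_mult[symmetric])
qed

lemma S_ge_1: "0 \<in> X \<Longrightarrow> 1 \<le> S X"
  unfolding S_def using cSUP_upper[of 0 "D \<inter> X" "\<lambda>t. exp (z t)"] bdd_exp D0 z0 by simp

lemma ratio_moment:
  assumes X: "X \<in> sets borel" "0 \<in> X"
    and left: "\<And>t. t \<in> X \<Longrightarrow> 0 \<le> t \<Longrightarrow> {t-1..t} \<subseteq> X"
    and right: "\<And>t. t \<in> X \<Longrightarrow> t < 0 \<Longrightarrow> {t..t+1} \<subseteq> X"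
    and q: "0 < q" "q + 1 / 4 \<le> l"
  shows "0 < I X" "(S X / I X) powr q \<le> exp (q + 1) * W UNIV"
proof -
  \<comment> \<open>The supremum may not be attained, so a point within the factor
    \<open>exp (-1)\<close> of it is taken.\<close>
  have "exp (-1) * S X < S X"
    using S_ge_1[OF X(2)] by simp
  then obtain t where t: "t \<in> D" "t \<in> X" "exp (-1) * S X < exp (z t)"
    unfolding S_def by (subst (asm) less_cSUP_iff) (use bdd_exp D0 X in auto)
  define m where "m = block_index t"
  \<comment> \<open>The unit interval from \<open>t\<close> towards 0: it has mass at least 1 and
    lies both in \<open>X\<close> and in the block of \<open>t\<close>.\<close>
  define J where "J = (if 0 \<le> t then {t-1..t} else {t..t+1})"
  have J: "J \<subseteq> X" "J \<subseteq> block m" "1 \<le> emeasure \<nu> J" "J \<in> sets borel" "t \<in> J" "compact J"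
    using left[OF t(2)] right[OF t(2)] block_index_left[of t] block_index_right[of t]
      mass_left[OF t(1)] mass_right[OF t(1)] by (auto simp: J_def m_def)
  obtain s where s: "s \<in> J" "\<And>y. y \<in> J \<Longrightarrow> z s \<le> z y"
    using continuous_attains_inf[OF J(6), of z] J(5) continuous_on_subset[OF cont] by blast
  have "ennreal (exp (z s)) \<le> ennreal (exp (z s)) * emeasure \<nu> J"
    using mult_left_mono[OF J(3), of "ennreal (exp (z s))"] by simp
  also have "\<dots> = (\<integral>\<^sup>+y. ennreal (exp (z s)) * indicator J y \<partial>\<nu>)"
    using J(4) by (intro nn_integral_cmult_indicator[symmetric]) (simp add: sets_\<nu>)
  also have "\<dots> \<le> (\<integral>\<^sup>+y. ennreal (exp (z y) * indicator X y) \<partial>\<nu>)"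
    using J(1) s(2) by (intro nn_integral_mono) (auto split: split_indicator)
  also have "\<dots> = ennreal (I X)" by (rule ennreal_I[OF X(1), symmetric])
  finally have I_ge: "exp (z s) \<le> I X"
    by (simp add: ennreal_le_iff2)
  then show I_pos: "0 < I X" by (rule less_le_trans[OF exp_gt_zero])
  have zt: "-1 \<le> z t"
  proof -
    have "exp (-1) * 1 \<le> exp (-1) * S X" using S_ge_1[OF X(2)] by simp
    from le_less_trans[OF this t(3)] show ?thesis by simp
  qed
  have "S X / I X \<le> exp (1 + (z t - z s))"
  proof -
    have "S X \<le> exp 1 * exp (z t)"
      using t(3) mult_left_mono[of "exp (-1) * S X" "exp (z t)" "exp 1"]
      by (simp add: mult.assoc[symmetric] exp_add[symmetric])
    also have "\<dots> = exp (1 + (z t - z s)) * exp (z s)" by (simp add: exp_add[symmetric])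
    also have "\<dots> \<le> exp (1 + (z t - z s)) * I X" using I_ge by simp
    finally show ?thesis using I_pos by (simp add: divide_le_eq)
  qed
  then have "(S X / I X) powr q \<le> exp (1 + (z t - z s)) powr q"
    using S_ge_1[OF X(2)] I_pos q by (intro powr_mono2) auto
  also have "\<dots> = exp (q + q * (z t - z s))"
    by (simp add: powr_def algebra_simps)
  also have "\<dots> \<le> exp (q + 1 + (z (of_int m) / 4 + l * max \<bar>z t - z s\<bar> \<bar>z t - z (of_int m)\<bar>))"
  proof -
    \<comment> \<open>The summand \<open>z m / 4\<close> of the majorant may be negative, but
      \<open>z t \<ge> -1\<close> keeps it above -1/4 minus a quarter of \<open>?w\<close>; this is
      the extra 1/4 in \<open>q + 1/4 \<le> l\<close>. The maximum is attained by one of two pairs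
      in the block, so \<open>u_ge\<close> covers it.\<close>
    let ?w = "max \<bar>z t - z s\<bar> \<bar>z t - z (of_int m)\<bar>"
    have "q * (z t - z s) \<le> q * ?w" using q by (intro mult_left_mono) auto
    moreover have "(q + 1/4) * ?w \<le> l * ?w" using q by (intro mult_right_mono) auto
    moreover have "z t \<le> z (of_int m) + ?w" by linarith
    ultimately show ?thesis using zt by (simp add: distrib_right)
  qed
  also have "\<dots> = exp (q + 1) * exp (z (of_int m) / 4 + l * max \<bar>z t - z s\<bar> \<bar>z t - z (of_int m)\<bar>)"
    by (simp add: exp_add)
  also have "\<dots> \<le> exp (q + 1) * W UNIV"
  proof (rule mult_left_mono)
    have mem: "t \<in> block m" "s \<in> block m" "of_int m \<in> block m"
      using J s(1) by (auto simp: block_def)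
    have "ennreal (exp (z (of_int m) / 4 + l * max \<bar>z t - z s\<bar> \<bar>z t - z (of_int m)\<bar>)) \<le> u m"
      using u_ge[OF mem(1,2)] u_ge[OF mem(1,3)] by (simp add: max_def)
    also have "\<dots> \<le> ennreal (W UNIV)" by (rule u_le_W) simp
    finally show "exp (z (of_int m) / 4 + l * max \<bar>z t - z s\<bar> \<bar>z t - z (of_int m)\<bar>) \<le> W UNIV"
      using W_nonneg by simp
  qed simp
  finally show "(S X / I X) powr q \<le> exp (q + 1) * W UNIV" .
qed

text \<open>The arithmetic-geometric mean inequality doubles \<open>p\<close>, and the inverse power
  of the denominator costs another 1/4. Together with the 1/4 demanded by
  \<open>ratio_moment\<close> this is the condition \<open>2 * p + 1/2 \<le> l\<close>.\<close>

lemma ratio_difference: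
  fixes p T \<rho> :: real
  assumes p: "0 < p" "2 * p + 1 / 2 \<le> l" and T: "1 \<le> T" and \<rho>: "0 < \<rho>"
  shows "\<bar>(S {-T..T} / I {-T..T}) powr p - (S UNIV / I UNIV) powr p\<bar>
    \<le> (1 + p) * exp (2 * p + 2) * (W UNIV / \<rho> + \<rho> * W {m. T - 1 < \<bar>of_int m\<bar>})"
proof -
  define \<xi>T where "\<xi>T = S {-T..T} / I {-T..T}"
  define \<xi> where "\<xi> = S UNIV / I UNIV"
  define U where "U = W UNIV"
  define V where "V = W {m. T - 1 < \<bar>of_int m\<bar>}"
  have UV: "0 \<le> U" "0 \<le> V" by (simp_all add: U_def V_def W_nonneg)
  have mT: "0 < I {-T..T}" "\<xi>T powr q \<le> exp (q + 1) * U" if "0 < q" "q + 1/4 \<le> l" for q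
    unfolding \<xi>T_def U_def using T that by (intro ratio_moment; auto)+
  have mU: "0 < I UNIV" "\<xi> powr q \<le> exp (q + 1) * U" if "0 < q" "q + 1/4 \<le> l" for q
    unfolding \<xi>_def U_def using that by (intro ratio_moment; auto)+
  have I_pos: "0 < I {-T..T}" "0 < I UNIV"
    using mT(1)[of p] mU(1)[of p] p by auto
  have S1: "1 \<le> S {-T..T}" "1 \<le> S UNIV" using T by (auto intro: S_ge_1)
  have \<xi>0: "0 < \<xi>T" "0 < \<xi>" using I_pos S1 by (auto simp: \<xi>T_def \<xi>_def)
  have sq: "(x powr p)\<^sup>2 = x powr (2 * p)" for x :: real
    by (simp add: power2_eq_square powr_add[symmetric])
  have amgm: "a * b \<le> (a\<^sup>2 / \<rho> + \<rho> * b\<^sup>2) / 2" for a b :: real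
  proof -
    have "0 \<le> (a - \<rho> * b)\<^sup>2 / \<rho>" using \<rho> by simp
    also have "\<dots> = a\<^sup>2 / \<rho> + \<rho> * b\<^sup>2 - 2 * (a * b)"
      using \<rho> by (simp add: power2_eq_square field_simps)
    finally show ?thesis by simp
  qed
  \<comment> \<open>Rounding towards 0 loses less than 1, hence the threshold T - 1 instead of
    T.\<close>
  have out: "block_index t \<in> {m. T - 1 < \<bar>of_int m\<bar>}" if "t \<notin> {-T..T}" for t
    using block_index_abs[of t] that by auto
  have S_le: "S {-T..T} \<le> S UNIV"
    unfolding S_def using D0 T bdd_exp by (intro cSUP_subset_mono) auto
  \<comment> \<open>The bounds \<open>e1\<close>, \<open>e3\<close> and \<open>e4\<close> merge the
    constants of the two cases into \<open>(1 + p) * exp (2 * p + 2)\<close>.\<close>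
  have e1: "exp (2 * p + 1) \<le> (1 + p) * exp (2 * p + 2)"
  proof -
    have "1 * exp (2 * p + 1) \<le> (1 + p) * exp (2 * p + 2)" using p by (intro mult_mono) auto
    then show ?thesis by simp
  qed
  have e3: "3 \<le> exp (2 * p + 2)"
    using exp_ge_add_one_self[of "2 * p + 2"] p by linarith
  have e4: "1 \<le> (1 + p) * exp (2 * p + 2)"
    using mult_mono[of 1 "1 + p" 1 "exp (2 * p + 2)"] p by simp
  have "\<bar>\<xi>T powr p - \<xi> powr p\<bar> \<le> (1 + p) * exp (2 * p + 2) * (U / \<rho> + \<rho> * V)"
  proof (cases "S {-T..T} < S UNIV")
    case True
    then obtain t where t: "t \<in> D" "S {-T..T} < exp (z t)"
      unfolding S_def[of UNIV] by (subst (asm) less_cSUP_iff) (use bdd_exp D0 in auto)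
    have "t \<notin> {-T..T}"
    proof
      assume "t \<in> {-T..T}"
      then have "exp (z t) \<le> S {-T..T}"
        unfolding S_def using t(1) bdd_exp by (intro cSUP_upper) auto
      then show False using t(2) by simp
    qed
    then have "exp (z t / 4) \<le> V"
      unfolding V_def by (intro exp_quarter_le_W[OF block_index_mem out])
    moreover have "1 \<le> exp (z t / 4)"
      using less_imp_le[OF le_less_trans[OF S1(1) t(2)]] by simp
    ultimately have V1: "1 \<le> V" by linarith
    \<comment> \<open>No cancellation between the two ratios is used here: each is multiplied by 1,
      and after the mean inequality this 1 is replaced by \<open>V\<close>.\<close>
    have "x powr p \<le> (exp (2 * p + 1) * U / \<rho> + \<rho> * V) / 2" if "x powr (2 * p) \<le> exp (2 * p + 1) * U" for x
    proof -
      have "x powr p * 1 \<le> ((x powr p)\<^sup>2 / \<rho> + \<rho> * 1\<^sup>2) / 2" by (rule amgm)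
      also have "\<dots> \<le> (exp (2 * p + 1) * U / \<rho> + \<rho> * V) / 2"
        using that V1 \<rho> by (intro divide_right_mono add_mono mult_left_mono) (auto simp: sq)
      finally show ?thesis by simp
    qed
    from this[OF mT(2)] this[OF mU(2)]
    have "\<xi>T powr p \<le> (exp (2 * p + 1) * U / \<rho> + \<rho> * V) / 2"
      and "\<xi> powr p \<le> (exp (2 * p + 1) * U / \<rho> + \<rho> * V) / 2"
      using p by auto
    moreover have "\<bar>a - b\<bar> \<le> c" if "a \<le> c / 2" "b \<le> c / 2" "0 \<le> a" "0 \<le> b" for a b c :: real
      using that by linarith
    ultimately have "\<bar>\<xi>T powr p - \<xi> powr p\<bar> \<le> exp (2 * p + 1) * U / \<rho> + \<rho> * V"
      by simp
    then have "\<bar>\<xi>T powr p - \<xi> powr p\<bar> \<le> exp (2 * p + 1) * (U / \<rho>) + 1 * (\<rho> * V)"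
      by simp
    also have "\<dots> \<le> (1 + p) * exp (2 * p + 2) * (U / \<rho>) + (1 + p) * exp (2 * p + 2) * (\<rho> * V)"
      using UV \<rho> by (intro add_mono mult_right_mono e1 e4) auto
    finally show ?thesis by (simp add: distrib_left)
  next
    case False
    then have S_eq: "S UNIV = S {-T..T}" using S_le by simp
    \<comment> \<open>The mass missing from the truncated denominator is the integral over the
      complement, hence at most \<open>3 * V ^ 4\<close>.\<close>
    define h where "h = I UNIV - I {-T..T}"
    have h_eq: "h = I (- {-T..T})"
    proof -
      have "I UNIV = I {-T..T} + I (- {-T..T})"
        unfolding I_def using set_integral_Un[of "{-T..T}" "- {-T..T}" \<nu> "\<lambda>t. exp (z t)"]
        by (simp add: integrable_exp)
      then show ?thesis by (simp add: h_def)
    qed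
    have h0: "0 \<le> h"
      unfolding h_eq I_def set_lebesgue_integral_def by (intro integral_nonneg_AE) auto
    have "ennreal h \<le> ennreal (3 * V ^ 4)"
      unfolding h_eq V_def using nn_integral_exp_le[of "- {-T..T}", OF _ out]
      by (subst ennreal_I) auto
    then have "h \<le> 3 * V ^ 4" using UV by simp
    also have "\<dots> \<le> (3 * V) ^ 4" using UV by (simp add: power_mult_distrib)
    finally have "h powr (1/4) \<le> ((3 * V) ^ 4) powr (1/4)"
      using h0 by (intro powr_mono2) auto
    also have "\<dots> = 3 * V"
    proof (cases "V = 0")
      case False
      then have "(3 * V) ^ 4 = (3 * V) powr 4" using UV by (simp add: powr_numeral)
      then show ?thesis using UV by (simp only: powr_powr) simp
    qed simp
    finally have h4: "h powr (1/4) \<le> 3 * V" .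
    have le: "\<xi> powr p \<le> \<xi>T powr p"
      unfolding \<xi>_def \<xi>T_def S_eq using p I_pos S1 h0
      by (intro powr_mono2 divide_left_mono) (auto simp: h_def)
    have "\<xi> = \<xi>T * (I {-T..T} / I UNIV)"
      unfolding \<xi>_def \<xi>T_def S_eq using I_pos by simp
    then have "\<xi> powr p = \<xi>T powr p * (I {-T..T} / I UNIV) powr p"
      by (simp only: powr_mult)
    then have "\<xi>T powr p - \<xi> powr p = \<xi>T powr p * (1 - (I {-T..T} / I UNIV) powr p)"
      by (simp add: right_diff_distrib)
    also have "\<dots> \<le> \<xi>T powr p * ((1 + p) * (h / I {-T..T}) powr (1/8))"
      unfolding h_def using I_pos h0 p by (intro mult_left_mono one_minus_powr_bound) (auto simp: h_def)
    also have "\<dots> = (1 + p) * ((\<xi>T powr p * (1 / I {-T..T}) powr (1/8)) * h powr (1/8))"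
      using I_pos h0 by (simp add: powr_divide)
    \<comment> \<open>The inverse denominator is grouped with \<xi>T and only the power of
      \<open>h\<close> is weighted by \<rho>, so that squaring leaves
      \<open>h powr (1/4) \<le> 3 * V\<close>.\<close>
    also have "\<dots> \<le> (1 + p) * (((\<xi>T powr p * (1 / I {-T..T}) powr (1/8))\<^sup>2 / \<rho> + \<rho> * (h powr (1/8))\<^sup>2) / 2)"
      using p by (intro mult_left_mono amgm) auto
    also have "(h powr (1/8))\<^sup>2 = h powr (1/4)"
      by (simp add: power2_eq_square powr_add[symmetric])
    also have "(\<xi>T powr p * (1 / I {-T..T}) powr (1/8))\<^sup>2 = \<xi>T powr (2 * p) * (1 / I {-T..T}) powr (1/4)"
      by (simp add: power_mult_distrib sq) (simp add: power2_eq_square powr_add[symmetric])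
    also have "(1 + p) * ((\<xi>T powr (2 * p) * (1 / I {-T..T}) powr (1/4) / \<rho> + \<rho> * h powr (1/4)) / 2)
        \<le> (1 + p) * ((exp (2 * p + 2) * U / \<rho> + \<rho> * (3 * V)) / 2)"
    proof -
      \<comment> \<open>Since the numerator is at least 1, the inverse denominator is itself bounded
        by \<xi>T, and no separate inverse moment has to be estimated.\<close>
      have "(1 / I {-T..T}) powr (1/4) \<le> \<xi>T powr (1/4)"
        unfolding \<xi>T_def using I_pos S1 by (intro powr_mono2 divide_right_mono) auto
      then have "\<xi>T powr (2 * p) * (1 / I {-T..T}) powr (1/4) \<le> \<xi>T powr (2 * p) * \<xi>T powr (1/4)"
        by (intro mult_left_mono) auto
      also have "\<dots> = \<xi>T powr (2 * p + 1/4)" by (simp add: powr_add)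
      also have "\<dots> \<le> exp (2 * p + 1/4 + 1) * U" using p by (intro mT(2)) auto
      also have "\<dots> \<le> exp (2 * p + 2) * U" using UV by (intro mult_right_mono) auto
      finally show ?thesis
        using p \<rho> h4 by (intro mult_left_mono divide_right_mono add_mono) auto
    qed
    also have "\<dots> = (1 + p) * ((exp (2 * p + 2) * (U / \<rho>) + 3 * (\<rho> * V)) / 2)" by simp
    also have "\<dots> \<le> (1 + p) * (exp (2 * p + 2) * (U / \<rho>) + exp (2 * p + 2) * (\<rho> * V))"
    proof (intro mult_left_mono)
      have V3: "3 * (\<rho> * V) \<le> exp (2 * p + 2) * (\<rho> * V)" using \<rho> UV e3 by (intro mult_right_mono) auto
      have half: "(a + b) / 2 \<le> a + c" if "b \<le> c" "0 \<le> a" "0 \<le> c" for a b c :: real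
        using that by (simp add: field_simps)
      show "(exp (2 * p + 2) * (U / \<rho>) + 3 * (\<rho> * V)) / 2 \<le> exp (2 * p + 2) * (U / \<rho>) + exp (2 * p + 2) * (\<rho> * V)"
        using \<rho> UV by (intro half[OF V3]) auto
    qed (use p in auto)
    finally show ?thesis using le by (simp add: distrib_left mult.assoc)
  qed
  then show ?thesis by (simp add: \<xi>T_def \<xi>_def U_def V_def)
qed

end

section \<open>Lattice measures and measurability\<close>

lemma Sup_real_cong_upper_bounds:
  fixes A B :: "real set"
  assumes "\<And>c. (\<forall>x\<in>A. x \<le> c) \<longleftrightarrow> (\<forall>x\<in>B. x \<le> c)"
  shows "Sup A = Sup B"
  \<comment> \<open>The real supremum is defined as the least upper bound, so it depends on the
    upper bounds alone, even for unbounded or empty sets.\<close>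
  unfolding Sup_real_def using assms by simp

text \<open>No boundedness is assumed. Boundedness is a measurable event because it can be tested
  with integer bounds, and on it the supremum agrees with the one in the extended reals.\<close>

lemma borel_measurable_SUP_real_countable:
  fixes f :: "'i \<Rightarrow> 'a \<Rightarrow> real"
  assumes I: "countable I" and [measurable]: "\<And>i. i \<in> I \<Longrightarrow> f i \<in> borel_measurable M"
  shows "(\<lambda>x. SUP i\<in>I. f i x) \<in> borel_measurable M"
proof (cases "I = {}")
  case False
  define b where "b x \<longleftrightarrow> (\<exists>n::nat. \<forall>i\<in>I. f i x \<le> real n)" for x
  have [measurable]: "Measurable.pred M b"
    unfolding b_def using I by measurable
  have b_iff: "b x \<longleftrightarrow> bdd_above ((\<lambda>i. f i x) ` I)" for x
  proof
    assume "bdd_above ((\<lambda>i. f i x) ` I)"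
    then obtain c where c: "\<And>i. i \<in> I \<Longrightarrow> f i x \<le> c" by (auto simp: bdd_above_def)
    obtain n where "c \<le> real n" using real_arch_simple by blast
    then show "b x" unfolding b_def using c by (meson order_trans)
  qed (auto simp: b_def bdd_above_def)
  \<comment> \<open>The supremum of an unbounded set of reals is a junk value, but always the same one.\<close>
  have "(SUP i\<in>I. f i x) = (if b x then real_of_ereal (SUP i\<in>I. ereal (f i x)) else Sup UNIV)" for x
  proof (cases "b x")
    case True
    then have bdd: "bdd_above ((\<lambda>i. f i x) ` I)" by (simp add: b_iff)
    have "ereal (SUP i\<in>I. f i x) = (SUP i\<in>I. ereal (f i x))"
    proof (rule ereal_SUP)
      obtain i where i: "i \<in> I" using False by blast
      have "ereal (f i x) \<le> (SUP i\<in>I. ereal (f i x))" using i by (rule SUP_upper)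
      moreover have "(SUP i\<in>I. ereal (f i x)) \<le> ereal (SUP i\<in>I. f i x)"
        using bdd by (intro SUP_least) (auto intro: cSUP_upper)
      ultimately show "\<bar>SUP i\<in>I. ereal (f i x)\<bar> \<noteq> \<infinity>" by auto
    qed
    then show ?thesis using True by (metis real_of_ereal.simps(1))
  next
    case nb: False
    have "(SUP i\<in>I. f i x) = Sup UNIV"
    proof (rule Sup_real_cong_upper_bounds)
      fix c :: real
      have "\<not> (\<forall>y\<in>(\<lambda>i. f i x) ` I. y \<le> c)"
        using nb unfolding b_iff bdd_above_def by blast
      moreover have "\<not> (\<forall>y\<in>UNIV. y \<le> c)"
        by (meson UNIV_I gt_ex not_less)
      ultimately show "(\<forall>y\<in>(\<lambda>i. f i x) ` I. y \<le> c) \<longleftrightarrow> (\<forall>y\<in>UNIV. y \<le> c)" by blast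
    qed
    then show ?thesis using nb by simp
  qed
  then show ?thesis using I by simp
qed simp

text \<open>By continuity a countable dense subset of \<open>X\<close> gives the same upper bounds,
  which reduces any index set to a countable one.\<close>

lemma borel_measurable_SUP_continuous:
  fixes f :: "'a \<Rightarrow> real \<Rightarrow> real"
  assumes [measurable]: "\<And>t. (\<lambda>\<omega>. f \<omega> t) \<in> borel_measurable M"
    and cont: "\<And>\<omega>. \<omega> \<in> space M \<Longrightarrow> continuous_on UNIV (f \<omega>)"
  shows "(\<lambda>\<omega>. SUP t\<in>X. f \<omega> t) \<in> borel_measurable M"
proof -
  obtain C where C: "countable C" "C \<subseteq> X" "X \<subseteq> closure C"
    by (rule separable)
  have "(SUP t\<in>X. f \<omega> t) = (SUP t\<in>C. f \<omega> t)" if "\<omega> \<in> space M" for \<omega>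
  proof (rule Sup_real_cong_upper_bounds, safe)
    fix c t assume le: "\<forall>y\<in>f \<omega> ` C. y \<le> c" and t: "t \<in> X"
    have "closed {s. f \<omega> s \<le> c}"
      using cont[OF that] by (intro closed_Collect_le continuous_intros) auto
    then have "closure C \<subseteq> {s. f \<omega> s \<le> c}"
      using le by (intro closure_minimal) auto
    then show "f \<omega> t \<le> c" using t C by blast
  next
    fix c t assume "\<forall>y\<in>f \<omega> ` X. y \<le> c" and "t \<in> C"
    then show "f \<omega> t \<le> c" using C by blast
  qed
  then have "(\<lambda>\<omega>. SUP t\<in>X. f \<omega> t) \<in> borel_measurable M
      \<longleftrightarrow> (\<lambda>\<omega>. SUP t\<in>C. f \<omega> t) \<in> borel_measurable M"
    by (rule measurable_cong)
  then show ?thesis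
    using borel_measurable_SUP_real_countable[OF C(1), of "\<lambda>t \<omega>. f \<omega> t" M] by simp
qed

text \<open>Rounding \<open>t\<close> down to a multiple of \<open>1 / Suc n\<close> leaves
  countably many sections, each measurable, and continuity gives the limit. The denominators are
  measurable in \<omega> through this joint measurability.\<close>

lemma borel_measurable_pair_continuous:
  fixes f :: "'a \<Rightarrow> real \<Rightarrow> real"
  assumes [measurable]: "\<And>t. (\<lambda>\<omega>. f \<omega> t) \<in> borel_measurable M"
    and cont: "\<And>\<omega>. \<omega> \<in> space M \<Longrightarrow> continuous_on UNIV (f \<omega>)"
  shows "(\<lambda>(\<omega>, t). f \<omega> t) \<in> borel_measurable (M \<Otimes>\<^sub>M borel)"
proof (rule borel_measurable_LIMSEQ_real)
  fix n :: nat
  have "(\<lambda>x. (\<lambda>i x. f (fst x) (real_of_int i / real (Suc n))) \<lfloor>snd x * real (Suc n)\<rfloor> x)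
      \<in> borel_measurable (M \<Otimes>\<^sub>M borel)"
    by (rule measurable_compose_countable) measurable
  then show "(\<lambda>x. f (fst x) (real_of_int \<lfloor>snd x * real (Suc n)\<rfloor> / real (Suc n)))
      \<in> borel_measurable (M \<Otimes>\<^sub>M borel)" by simp
next
  fix x assume x: "x \<in> space (M \<Otimes>\<^sub>M (borel :: real measure))"
  obtain \<omega> t where xt: "x = (\<omega>, t)" "\<omega> \<in> space M"
    using x by (auto simp: space_pair_measure)
  have bounds: "t - 1 / real (Suc n) \<le> real_of_int \<lfloor>t * real (Suc n)\<rfloor> / real (Suc n)"
    "real_of_int \<lfloor>t * real (Suc n)\<rfloor> / real (Suc n) \<le> t" for n
  proof -
    have "t * real (Suc n) - 1 \<le> real_of_int \<lfloor>t * real (Suc n)\<rfloor>" by linarith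
    then have "(t * real (Suc n) - 1) / real (Suc n) \<le> real_of_int \<lfloor>t * real (Suc n)\<rfloor> / real (Suc n)"
      by (intro divide_right_mono) auto
    then show "t - 1 / real (Suc n) \<le> real_of_int \<lfloor>t * real (Suc n)\<rfloor> / real (Suc n)"
      by (simp add: diff_divide_distrib del: of_nat_Suc)
    show "real_of_int \<lfloor>t * real (Suc n)\<rfloor> / real (Suc n) \<le> t"
      using of_int_floor_le[of "t * real (Suc n)"] by (simp add: divide_le_eq del: of_nat_Suc)
  qed
  have lim: "(\<lambda>n. t - 1 / real (Suc n)) \<longlonglongrightarrow> t - 0"
    by (intro tendsto_diff tendsto_const LIMSEQ_Suc lim_1_over_n)
  have "(\<lambda>n. real_of_int \<lfloor>t * real (Suc n)\<rfloor> / real (Suc n)) \<longlonglongrightarrow> t"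
    by (rule tendsto_sandwich[OF _ _ lim[unfolded diff_zero] tendsto_const])
      (intro always_eventually allI bounds)+
  then have "(\<lambda>n. f \<omega> (real_of_int \<lfloor>t * real (Suc n)\<rfloor> / real (Suc n))) \<longlonglongrightarrow> f \<omega> t"
    using continuous_on_tendsto_compose[OF cont[OF xt(2)]] by auto
  then show "(\<lambda>n. f (fst x) (real_of_int \<lfloor>snd x * real (Suc n)\<rfloor> / real (Suc n)))
      \<longlonglongrightarrow> (case x of (\<omega>, t) \<Rightarrow> f \<omega> t)"
    by (simp add: xt)
qed

text \<open>For real families summability is absolute summability, and both sides default to 0 when
  it fails.\<close>

lemma infsum_eq_integral_count_space:
  fixes f :: "'b \<Rightarrow> real"
  shows "(\<Sum>\<^sub>\<infinity>k\<in>A. f k) = (\<integral>k. f k \<partial>count_space A)"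
proof (cases "Infinite_Set_Sum.abs_summable_on f A")
  case True
  then show ?thesis using infsetsum_infsum[OF True] by (simp add: infsetsum_def)
next
  case False
  then have "\<not> f summable_on A"
    using summable_on_iff_abs_summable_on_real abs_summable_equivalent by blast
  moreover have "\<not> integrable (count_space A) f"
    using False by (simp add: abs_summable_on_def)
  ultimately show ?thesis
    by (simp add: infsum_not_exists not_integrable_integral_eq)
qed

section \<open>The grid and its measure on the real line\<close>

definition grid :: "real \<Rightarrow> real set" where
  "grid \<delta> = (if \<delta> = 0 then UNIV else range (\<lambda>k::int. \<delta> * of_int k))"

text \<open>The weighted counting measure is pushed forward to the reals so that \<delta> = 0 and
  \<delta> > 0 instantiate the same locale.\<close>

definition grid_measure :: "real \<Rightarrow> real measure" where
  "grid_measure \<delta> = (if \<delta> = 0 then lborel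
     else distr (density (count_space (UNIV::int set)) (\<lambda>_. ennreal \<delta>)) borel (\<lambda>k. \<delta> * of_int k))"

lemma sets_grid_measure [measurable_cong]: "sets (grid_measure \<delta>) = sets borel"
  by (simp add: grid_measure_def)

lemma integral_grid_measure:
  fixes f :: "real \<Rightarrow> real"
  assumes "0 < \<delta>" and f [measurable]: "f \<in> borel_measurable borel"
  shows "(\<integral>t. f t \<partial>grid_measure \<delta>) = \<delta> * (\<integral>k. f (\<delta> * of_int k) \<partial>count_space (UNIV::int set))"
proof -
  have "(\<integral>t. f t \<partial>grid_measure \<delta>)
      = (\<integral>k. f (\<delta> * of_int k) \<partial>density (count_space (UNIV::int set)) (\<lambda>_. ennreal \<delta>))"
    using assms(1) unfolding grid_measure_def by (simp add: integral_distr)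
  also have "\<dots> = (\<integral>k. \<delta> *\<^sub>R f (\<delta> * of_int k) \<partial>count_space (UNIV::int set))"
    using assms(1) by (intro integral_density) auto
  finally show ?thesis by simp
qed

lemma int_multiples_in_Icc:
  assumes "0 < \<delta>"
  shows "{k::int. \<delta> * of_int k \<in> {a..b}} = {\<lceil>a / \<delta>\<rceil>..\<lfloor>b / \<delta>\<rfloor>}"
  using assms by (auto simp: ceiling_le_iff le_floor_iff field_simps)

lemma emeasure_grid_measure_Icc:
  assumes \<delta>: "0 < \<delta>"
  shows "emeasure (grid_measure \<delta>) {a..b} = ennreal (\<delta> * real (card {\<lceil>a / \<delta>\<rceil>..\<lfloor>b / \<delta>\<rfloor>}))"
proof -
  have "emeasure (grid_measure \<delta>) {a..b}
      = emeasure (density (count_space (UNIV::int set)) (\<lambda>_. ennreal \<delta>)) {k. \<delta> * of_int k \<in> {a..b}}"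
    using \<delta> unfolding grid_measure_def by (simp add: emeasure_distr vimage_def)
  also have "\<dots> = ennreal \<delta> * emeasure (count_space UNIV) {k::int. \<delta> * of_int k \<in> {a..b}}"
    by (simp add: emeasure_density nn_integral_cmult_indicator)
  also have "\<dots> = ennreal (\<delta> * real (card {\<lceil>a / \<delta>\<rceil>..\<lfloor>b / \<delta>\<rfloor>}))"
    unfolding int_multiples_in_Icc[OF \<delta>] using \<delta>
    by (simp add: ennreal_mult ennreal_of_nat_eq_real_of_nat)
  finally show ?thesis .
qed

lemma card_Icc_int_bounds:
  fixes a b :: int
  shows "real_of_int b - real_of_int a + 1 \<le> real (card {a..b})"
    and "real (card {a..b}) \<le> max 0 (real_of_int b - real_of_int a + 1)"
  by auto

text \<open>One end point lies on the lattice, so the interval contains floor (1 / \<delta>) + 1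
  lattice points, which is at least 1 / \<delta>; without that end point the count could fall
  short.\<close>

lemma grid_measure_left:
  assumes "0 \<le> \<delta>" "t \<in> grid \<delta>" shows "1 \<le> emeasure (grid_measure \<delta>) {t-1..t}"
proof (cases "\<delta> = 0")
  case True then show ?thesis by (simp add: grid_measure_def)
next
  case False
  then have \<delta>: "0 < \<delta>" using assms by simp
  obtain k :: int where k: "t = \<delta> * of_int k" using assms False by (auto simp: grid_def)
  have "1 / \<delta> \<le> real (card {\<lceil>(t - 1) / \<delta>\<rceil>..\<lfloor>t / \<delta>\<rfloor>})"
  proof -
    have eq: "(t - 1) / \<delta> = of_int k - 1 / \<delta>" "t / \<delta> = of_int k"
      using \<delta> by (simp_all add: k diff_divide_distrib)
    have "1 / \<delta> \<le> real_of_int \<lfloor>t / \<delta>\<rfloor> - real_of_int \<lceil>(t - 1) / \<delta>\<rceil> + 1"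
      using of_int_ceiling_le_add_one[of "(t - 1) / \<delta>"] unfolding eq floor_of_int by argo
    then show ?thesis using card_Icc_int_bounds(1) by (rule order_trans)
  qed
  then have "1 \<le> \<delta> * real (card {\<lceil>(t - 1) / \<delta>\<rceil>..\<lfloor>t / \<delta>\<rfloor>})"
    using \<delta> by (simp add: divide_le_eq mult.commute del: card_atLeastAtMost_int)
  then show ?thesis by (simp add: emeasure_grid_measure_Icc[OF \<delta>] del: card_atLeastAtMost_int)
qed

lemma grid_measure_right:
  assumes "0 \<le> \<delta>" "t \<in> grid \<delta>" shows "1 \<le> emeasure (grid_measure \<delta>) {t..t+1}"
proof (cases "\<delta> = 0")
  case True then show ?thesis by (simp add: grid_measure_def)
next
  case False
  then have \<delta>: "0 < \<delta>" using assms by simp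
  obtain k :: int where k: "t = \<delta> * of_int k" using assms False by (auto simp: grid_def)
  have "1 / \<delta> \<le> real (card {\<lceil>t / \<delta>\<rceil>..\<lfloor>(t + 1) / \<delta>\<rfloor>})"
  proof -
    have eq: "(t + 1) / \<delta> = of_int k + 1 / \<delta>" "t / \<delta> = of_int k"
      using \<delta> by (simp_all add: k add_divide_distrib)
    have "1 / \<delta> \<le> real_of_int \<lfloor>(t + 1) / \<delta>\<rfloor> - real_of_int \<lceil>t / \<delta>\<rceil> + 1"
      using real_of_int_floor_add_one_ge[of "(t + 1) / \<delta>"] unfolding eq by simp
    then show ?thesis using card_Icc_int_bounds(1) by (rule order_trans)
  qed
  then have "1 \<le> \<delta> * real (card {\<lceil>t / \<delta>\<rceil>..\<lfloor>(t + 1) / \<delta>\<rfloor>})"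
    using \<delta> by (simp add: divide_le_eq mult.commute del: card_atLeastAtMost_int)
  then show ?thesis by (simp add: emeasure_grid_measure_Icc[OF \<delta>] del: card_atLeastAtMost_int)
qed

text \<open>An interval of length two holds at most 2 / \<delta> + 1 lattice points, of total mass
  at most 2 + \<delta>, and \<delta> \<le> 1 turns this into 3.\<close>

lemma grid_measure_block:
  assumes "0 \<le> \<delta>" "\<delta> \<le> 1" shows "emeasure (grid_measure \<delta>) (block m) \<le> 3"
proof (cases "\<delta> = 0")
  case True then show ?thesis
    by (simp add: grid_measure_def block_def ennreal_numeral[symmetric] del: ennreal_numeral)
next
  case False
  then have \<delta>: "0 < \<delta>" using assms by simp
  have "real (card {\<lceil>(of_int m - 1) / \<delta>\<rceil>..\<lfloor>(of_int m + 1) / \<delta>\<rfloor>}) \<le> 2 / \<delta> + 1"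
  proof -
    have "real_of_int \<lfloor>(of_int m + 1) / \<delta>\<rfloor> - real_of_int \<lceil>(of_int m - 1) / \<delta>\<rceil> + 1
        \<le> (of_int m + 1) / \<delta> - (of_int m - 1) / \<delta> + 1"
      by (intro add_right_mono diff_mono of_int_floor_le le_of_int_ceiling)
    also have "\<dots> = 2 / \<delta> + 1" by (simp add: diff_divide_distrib[symmetric])
    finally have "max 0 (real_of_int \<lfloor>(of_int m + 1) / \<delta>\<rfloor> - real_of_int \<lceil>(of_int m - 1) / \<delta>\<rceil> + 1) \<le> 2 / \<delta> + 1"
      using \<delta> by (intro max.boundedI) auto
    then show ?thesis by (rule order_trans[OF card_Icc_int_bounds(2)])
  qed
  then have "\<delta> * real (card {\<lceil>(of_int m - 1) / \<delta>\<rceil>..\<lfloor>(of_int m + 1) / \<delta>\<rfloor>}) \<le> \<delta> * (2 / \<delta> + 1)"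
    using \<delta> by (intro mult_left_mono) auto
  also have "\<dots> \<le> 3" using \<delta> assms by (simp add: distrib_left)
  finally show ?thesis
    unfolding block_def emeasure_grid_measure_Icc[OF \<delta>]
    by (simp add: ennreal_numeral[symmetric] del: ennreal_numeral card_atLeastAtMost_int)
qed

section \<open>The two ratios in terms of the grid measure\<close>

lemma xi_grid:
  assumes "0 \<le> \<delta>" and [measurable]: "Zp \<alpha> B \<omega> \<in> borel_measurable borel"
  shows "xi \<alpha> B \<delta> \<omega> = (SUP t\<in>grid \<delta> \<inter> UNIV. exp (Zp \<alpha> B \<omega> t))
    / (\<integral>t\<in>UNIV. exp (Zp \<alpha> B \<omega> t) \<partial>grid_measure \<delta>)"
proof (cases "\<delta> = 0")
  case True
  then show ?thesis
    by (simp add: xi_def grid_def grid_measure_def set_lebesgue_integral_def)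
next
  case False
  then have "0 < \<delta>" using assms by simp
  then show ?thesis
    by (simp add: xi_def grid_def set_lebesgue_integral_def integral_grid_measure
        infsum_eq_integral_count_space image_image)
qed

lemma xiT_grid:
  assumes "0 \<le> \<delta>" "0 \<le> T" and [measurable]: "Zp \<alpha> B \<omega> \<in> borel_measurable borel"
  shows "xiT \<alpha> B \<delta> T \<omega> = (SUP t\<in>grid \<delta> \<inter> {-T..T}. exp (Zp \<alpha> B \<omega> t))
    / (\<integral>t\<in>{-T..T}. exp (Zp \<alpha> B \<omega> t) \<partial>grid_measure \<delta>)"
proof (cases "\<delta> = 0")
  case True
  then show ?thesis
    using interval_integral_Icc[of "-T" T "\<lambda>t. exp (Zp \<alpha> B \<omega> t)"] assms
    by (simp add: xiT_def grid_def grid_measure_def)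
next
  case False
  then have \<delta>: "0 < \<delta>" using assms by simp
  let ?K = "{k::int. \<bar>\<delta> * of_int k\<bar> \<le> T}"
  have K: "?K = {k. \<delta> * of_int k \<in> {-T..T}}" by auto
  have fin: "finite ?K" unfolding K int_multiples_in_Icc[OF \<delta>] by simp
  have img: "grid \<delta> \<inter> {-T..T} = (\<lambda>k. \<delta> * of_int k) ` ?K"
    using False by (auto simp: grid_def)
  have "(\<integral>t\<in>{-T..T}. exp (Zp \<alpha> B \<omega> t) \<partial>grid_measure \<delta>)
      = \<delta> * (\<integral>k. indicat_real {-T..T} (\<delta> * of_int k) * exp (Zp \<alpha> B \<omega> (\<delta> * of_int k)) \<partial>count_space (UNIV::int set))"
    using \<delta> by (simp add: set_lebesgue_integral_def integral_grid_measure)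
  also have "(\<integral>k. indicat_real {-T..T} (\<delta> * of_int k) * exp (Zp \<alpha> B \<omega> (\<delta> * of_int k)) \<partial>count_space (UNIV::int set))
      = (\<Sum>k\<in>?K. exp (Zp \<alpha> B \<omega> (\<delta> * of_int k)))"
  proof -
    have supp: "{k\<in>UNIV. indicat_real {-T..T} (\<delta> * of_int k) * exp (Zp \<alpha> B \<omega> (\<delta> * of_int k)) \<noteq> 0} = ?K"
      by (auto simp: indicator_def abs_le_iff)
    show ?thesis
      by (subst lebesgue_integral_count_space_finite_support)
        (use fin supp in \<open>auto simp: indicator_def abs_le_iff intro!: sum.cong\<close>)
  qed
  finally show ?thesis
    using False by (simp add: xiT_def img image_image)
qed

lemma sigma_finite_grid_measure:
  assumes "0 \<le> \<delta>" "\<delta> \<le> 1" shows "sigma_finite_measure (grid_measure \<delta>)"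
proof
  show "\<exists>A. countable A \<and> A \<subseteq> sets (grid_measure \<delta>) \<and> \<Union>A = space (grid_measure \<delta>) \<and>
      (\<forall>a\<in>A. emeasure (grid_measure \<delta>) a \<noteq> \<infinity>)"
  proof (intro exI[of _ "range block"] conjI ballI)
    show "range block \<subseteq> sets (grid_measure \<delta>)"
      by (auto simp: sets_grid_measure block_def)
    have "space (grid_measure \<delta>) = UNIV"
      using sets_eq_imp_space_eq[OF sets_grid_measure] by simp
    then show "\<Union>(range block) = space (grid_measure \<delta>)"
      using block_index_mem by blast
    have "emeasure (grid_measure \<delta>) (block m) < \<infinity>" for m
      by (rule le_less_trans[OF grid_measure_block[OF assms]]) simp
    then show "emeasure (grid_measure \<delta>) a \<noteq> \<infinity>" if "a \<in> range block" for a
      using that by (metis rangeE less_irrefl)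
  qed simp
qed

lemma Zp_continuous:
  assumes "is_fbm M \<alpha> B" "0 < \<alpha>" "\<omega> \<in> space M"
  shows "continuous_on UNIV (Zp \<alpha> B \<omega>)"
  unfolding Zp_def[abs_def] using is_fbm_D(3)[OF assms(1,3)] assms(2)
  by (intro continuous_intros continuous_on_powr') auto

lemma Zp_measurable:
  assumes "is_fbm M \<alpha> B" shows "(\<lambda>\<omega>. Zp \<alpha> B \<omega> t) \<in> borel_measurable M"
  using is_fbm_D(2)[OF assms] unfolding Zp_def by measurable

text \<open>Guarantees that the expectations in the theorem are genuine, since the Bochner integral
  of a nonmeasurable function is 0 by default.\<close>

lemma borel_measurable_grid_ratio:
  assumes B: "is_fbm M \<alpha> B" and \<alpha>: "0 < \<alpha>" and \<delta>: "0 \<le> \<delta>" "\<delta> \<le> 1" and [measurable]: "X \<in> sets borel"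
  shows "(\<lambda>\<omega>. (SUP t\<in>grid \<delta> \<inter> X. exp (Zp \<alpha> B \<omega> t))
    / (\<integral>t\<in>X. exp (Zp \<alpha> B \<omega> t) \<partial>grid_measure \<delta>)) \<in> borel_measurable M"
proof -
  interpret sigma_finite_measure "grid_measure \<delta>"
    by (rule sigma_finite_grid_measure[OF \<delta>])
  note [measurable] = Zp_measurable[OF B]
  have pair: "(\<lambda>(\<omega>, t). Zp \<alpha> B \<omega> t) \<in> borel_measurable (M \<Otimes>\<^sub>M borel)"
    by (rule borel_measurable_pair_continuous) (auto intro: Zp_continuous[OF B \<alpha>])
  have [measurable]: "(\<lambda>(\<omega>, t). Zp \<alpha> B \<omega> t) \<in> borel_measurable (M \<Otimes>\<^sub>M grid_measure \<delta>)"
    using pair by (simp cong: measurable_cong_sets add: sets_pair_measure_cong[OF refl sets_grid_measure])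
  have "(\<lambda>\<omega>. SUP t\<in>grid \<delta> \<inter> X. exp (Zp \<alpha> B \<omega> t)) \<in> borel_measurable M"
    by (rule borel_measurable_SUP_continuous) (auto intro!: continuous_intros Zp_continuous[OF B \<alpha>])
  moreover have "(\<lambda>\<omega>. \<integral>t\<in>X. exp (Zp \<alpha> B \<omega> t) \<partial>grid_measure \<delta>) \<in> borel_measurable M"
    unfolding set_lebesgue_integral_def by measurable
  ultimately show ?thesis by (rule borel_measurable_divide)
qed

section \<open>Speed of convergence\<close>

lemma summable_exp_minus_powr:
  fixes \<alpha> c :: real
  assumes \<alpha>: "0 < \<alpha>" and c: "0 < c"
  shows "summable (\<lambda>n. exp (- c * real n powr \<alpha>))"
proof -
  \<comment> \<open>From x / k \<le> exp (x / k) follows exp (- x) \<le> (k / x)^k; with k \<ge> 2 /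
    \<alpha> this is of order \<open>1 / n^2\<close>.\<close>
  obtain k :: nat where "2 / \<alpha> \<le> real k" using real_arch_simple by blast
  then have k2: "2 \<le> \<alpha> * real k" using \<alpha> by (simp add: divide_le_eq mult.commute)
  then have k: "0 < real k" using \<alpha> by (cases "k = 0") auto
  have "summable (\<lambda>n. (real k / c) ^ k * inverse (real n ^ 2))"
    by (intro summable_mult inverse_power_summable) simp
  then show ?thesis
  proof (rule summable_comparison_test_ev[rotated], intro eventually_sequentiallyI[of 1])
    fix n :: nat assume n: "1 \<le> n"
    define x where "x = c * real n powr \<alpha>"
    have x: "0 < x" using n c by (simp add: x_def)
    have "x / real k \<le> exp (x / real k)"
      by (rule order_trans[OF _ exp_ge_add_one_self]) simp
    then have "(x / real k) ^ k \<le> exp (x / real k) ^ k"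
      using x by (intro power_mono) auto
    also have "\<dots> = exp x" using k by (simp add: exp_of_nat_mult[symmetric])
    finally have "exp (- x) \<le> inverse ((x / real k) ^ k)"
      using x k by (simp add: exp_minus le_imp_inverse_le)
    also have "\<dots> = (real k / c) ^ k * inverse (real n powr (\<alpha> * real k))"
      using n c k by (simp add: x_def power_divide power_mult_distrib powr_realpow[symmetric] powr_powr field_simps)
    also have "\<dots> \<le> (real k / c) ^ k * inverse (real n powr 2)"
      using n c k k2 by (intro mult_left_mono le_imp_inverse_le powr_mono) auto
    also have "real n powr 2 = real n ^ 2" using n by (simp add: powr_numeral)
    finally show "norm (exp (- c * real n powr \<alpha>)) \<le> (real k / c) ^ k * inverse (real n ^ 2)"
      by (simp add: x_def)
  qed
qed

lemma nn_integral_exp_minus_powr_int: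
  fixes \<alpha> c :: real
  assumes \<alpha>: "0 < \<alpha>" and c: "0 < c"
  shows "(\<integral>\<^sup>+m. ennreal (exp (- c * \<bar>of_int m\<bar> powr \<alpha>)) \<partial>count_space (UNIV::int set)) < \<infinity>"
proof -
  define g where "g m = ennreal (exp (- c * \<bar>of_int m\<bar> powr \<alpha>))" for m :: int
  have half: "(\<integral>\<^sup>+m. g m \<partial>count_space A) < \<infinity>"
    if "bij_betw h UNIV A" "\<And>n. \<bar>h n\<bar> = int n" for A :: "int set" and h
  proof -
    have "(\<integral>\<^sup>+m. g m \<partial>count_space A) = (\<integral>\<^sup>+n. g (h n) \<partial>count_space UNIV)"
      by (rule nn_integral_bij_count_space[OF that(1), symmetric])
    also have "\<dots> = (\<Sum>n. ennreal (exp (- c * real n powr \<alpha>)))"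
    proof -
      have "\<bar>real_of_int (h n)\<bar> = real n" for n
        using that(2)[of n] by (metis of_int_abs of_int_of_nat_eq)
      then show ?thesis by (simp add: nn_integral_count_space_nat g_def)
    qed
    also have "\<dots> = ennreal (\<Sum>n. exp (- c * real n powr \<alpha>))"
      by (rule suminf_ennreal2[OF _ summable_exp_minus_powr[OF \<alpha> c]]) simp
    also have "\<dots> < \<infinity>" by simp
    finally show ?thesis .
  qed
  \<comment> \<open>Both half-lines contain 0; counting it twice only enlarges the bound.\<close>
  have "(\<integral>\<^sup>+m. g m \<partial>count_space UNIV)
      \<le> (\<integral>\<^sup>+m. g m * indicator {0..} m + g m * indicator {..0} m \<partial>count_space UNIV)"
    by (intro nn_integral_mono) (auto split: split_indicator)
  also have "\<dots> = (\<integral>\<^sup>+m. g m \<partial>count_space {0..}) + (\<integral>\<^sup>+m. g m \<partial>count_space {..0})"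
    by (simp add: nn_integral_add nn_integral_count_space_indicator)
  also have "\<dots> < \<infinity>"
  proof -
    have "(\<integral>\<^sup>+m. g m \<partial>count_space {0..}) < \<infinity>"
      by (rule half[of int], rule bij_betwI[where g=nat]) auto
    moreover have "(\<integral>\<^sup>+m. g m \<partial>count_space {..0}) < \<infinity>"
      by (rule half[of "\<lambda>n. - int n"], rule bij_betwI[where g="\<lambda>m. nat (- m)"]) auto
    ultimately show ?thesis by (simp add: less_top)
  qed
  finally show ?thesis by (simp add: g_def)
qed

lemma borel_measurable_nn_integral_count_int:
  fixes U :: "int \<Rightarrow> 'a \<Rightarrow> ennreal"
  assumes [measurable]: "\<And>m. U m \<in> borel_measurable M"
  shows "(\<lambda>\<omega>. \<integral>\<^sup>+m. U m \<omega> \<partial>count_space UNIV) \<in> borel_measurable M"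
proof -
  have "(\<integral>\<^sup>+m. U m \<omega> \<partial>count_space UNIV) = (\<Sum>n. U (int_decode n) \<omega>)" for \<omega>
    using nn_integral_bij_count_space[OF bij_int_decode, of "\<lambda>m. U m \<omega>"]
    by (simp add: nn_integral_count_space_nat)
  then show ?thesis by simp
qed

text \<open>The rate 1/16 is split evenly: one half gives the factor \<open>exp (- a / 32)\<close>,
  the other half keeps the series over the integers convergent.\<close>

lemma nn_integral_tail_bound:
  fixes U :: "int \<Rightarrow> 'a \<Rightarrow> ennreal" and C \<alpha> a :: real
  assumes [measurable]: "\<And>m. U m \<in> borel_measurable M"
    and EU: "\<And>m. (\<integral>\<^sup>+\<omega>. U m \<omega> \<partial>M) \<le> ennreal (C * exp (- (\<bar>of_int m\<bar> powr \<alpha>) / 16))"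
    and C: "0 \<le> C" and N: "\<And>m. m \<in> N \<Longrightarrow> a \<le> \<bar>of_int m\<bar> powr \<alpha>"
  shows "(\<integral>\<^sup>+\<omega>. \<integral>\<^sup>+m. U m \<omega> * indicator N m \<partial>count_space UNIV \<partial>M)
    \<le> ennreal (C * exp (- a / 32)) * (\<integral>\<^sup>+m. ennreal (exp (- (1/32) * \<bar>of_int m\<bar> powr \<alpha>)) \<partial>count_space UNIV)"
proof -
  have "(\<integral>\<^sup>+\<omega>. \<integral>\<^sup>+m. U m \<omega> * indicator N m \<partial>count_space UNIV \<partial>M)
      = (\<integral>\<^sup>+m. \<integral>\<^sup>+\<omega>. U m \<omega> * indicator N m \<partial>M \<partial>count_space UNIV)"
    by (rule nn_integral_count_space_nn_integral) auto
  also have "\<dots> \<le> (\<integral>\<^sup>+m. ennreal (C * exp (- a / 32)) * ennreal (exp (- (1/32) * \<bar>of_int m\<bar> powr \<alpha>)) \<partial>count_space UNIV)"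
  proof (rule nn_integral_mono)
    fix m :: int
    show "(\<integral>\<^sup>+\<omega>. U m \<omega> * indicator N m \<partial>M)
      \<le> ennreal (C * exp (- a / 32)) * ennreal (exp (- (1/32) * \<bar>of_int m\<bar> powr \<alpha>))"
    proof (cases "m \<in> N")
      case True
      then have "(\<integral>\<^sup>+\<omega>. U m \<omega> * indicator N m \<partial>M) \<le> ennreal (C * exp (- (\<bar>of_int m\<bar> powr \<alpha>) / 16))"
        using EU[of m] by simp
      also have "\<dots> \<le> ennreal (C * (exp (- a / 32) * exp (- (1/32) * \<bar>of_int m\<bar> powr \<alpha>)))"
        using C N[OF True] by (intro ennreal_leI mult_left_mono) (auto simp: exp_add[symmetric])
      finally show ?thesis using C by (simp add: ennreal_mult[symmetric] mult.assoc)
    qed simp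
  qed
  also have "\<dots> = ennreal (C * exp (- a / 32)) * (\<integral>\<^sup>+m. ennreal (exp (- (1/32) * \<bar>of_int m\<bar> powr \<alpha>)) \<partial>count_space UNIV)"
    by (rule nn_integral_cmult) simp
  finally show ?thesis .
qed

text \<open>Undoes the shift from T to T - 1. For T \<le> 2 the left side is at most 0; beyond that
  T \<le> 2 (T - 1), and 2^\<alpha> \<le> 4.\<close>

lemma powr_minus_one_ge:
  fixes \<alpha> T :: real
  assumes "0 < \<alpha>" "\<alpha> < 2" "1 \<le> T"
  shows "T powr \<alpha> / 4 - 1 \<le> (T - 1) powr \<alpha>"
proof (cases "T \<le> 2")
  case True
  then have "T powr \<alpha> \<le> 2 powr 2"
    using assms by (intro powr_mono_both) auto
  then show ?thesis by (simp add: order_trans[OF _ powr_ge_zero])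
next
  case False
  then have "T powr \<alpha> \<le> (2 * (T - 1)) powr \<alpha>" using assms by (intro powr_mono2) auto
  also have "\<dots> = 2 powr \<alpha> * (T - 1) powr \<alpha>" by (simp only: powr_mult)
  also have "\<dots> \<le> 2 powr 2 * (T - 1) powr \<alpha>"
    using assms by (intro mult_right_mono powr_mono) auto
  finally show ?thesis by simp
qed

text \<open>Instantiates the pathwise locale at a single \<omega>. The conditions that
  \<open>B\<close> starts at 0 and that the majorants are summable hold almost surely, so they are
  hypotheses on \<omega> here.\<close>

lemma fbm_pointwise_bounds:
  fixes \<alpha> p \<delta> T \<rho> :: real and U :: "int \<Rightarrow> 'a \<Rightarrow> ennreal"
  assumes B: "is_fbm M \<alpha> B" and \<alpha>: "0 < \<alpha>" and p: "0 < p"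
    and \<delta>: "0 \<le> \<delta>" "\<delta> \<le> 1" and T: "1 \<le> T" and \<rho>: "0 < \<rho>"
    and \<omega>: "\<omega> \<in> space M" "B 0 \<omega> = 0" "(\<integral>\<^sup>+m. U m \<omega> \<partial>count_space UNIV) < \<infinity>"
    and U: "\<And>m s t. s \<in> block m \<Longrightarrow> t \<in> block m \<Longrightarrow>
      ennreal (exp (Zp \<alpha> B \<omega> (of_int m) / 4 + (2 * p + 1 / 2) * \<bar>Zp \<alpha> B \<omega> s - Zp \<alpha> B \<omega> t\<bar>)) \<le> U m \<omega>"
  defines "V N \<equiv> \<integral>\<^sup>+m. U m \<omega> * indicator N m \<partial>count_space UNIV"
  shows "ennreal (xiT \<alpha> B \<delta> T \<omega> powr p) \<le> ennreal (exp (p + 1)) * V UNIV"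
    and "ennreal (xi \<alpha> B \<delta> \<omega> powr p) \<le> ennreal (exp (p + 1)) * V UNIV"
    and "ennreal \<bar>xiT \<alpha> B \<delta> T \<omega> powr p - xi \<alpha> B \<delta> \<omega> powr p\<bar>
      \<le> ennreal ((1 + p) * exp (2 * p + 2)) * (ennreal (1 / \<rho>) * V UNIV + ennreal \<rho> * V {m. T - 1 < \<bar>of_int m\<bar>})"
proof -
  interpret R: block_ratio "Zp \<alpha> B \<omega>" "grid \<delta>" "grid_measure \<delta>" "\<lambda>m. U m \<omega>" "2 * p + 1 / 2"
  proof
    show "continuous_on UNIV (Zp \<alpha> B \<omega>)" by (rule Zp_continuous[OF B \<alpha> \<omega>(1)])
    show "Zp \<alpha> B \<omega> 0 = 0" using \<omega>(2) \<alpha> by (simp add: Zp_def)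
    show "0 \<in> grid \<delta>" by (auto simp: grid_def intro!: image_eqI[of _ _ 0])
    show "sets (grid_measure \<delta>) = sets borel" by (rule sets_grid_measure)
  qed (use \<delta> p \<omega>(3) U in \<open>auto intro: grid_measure_left grid_measure_right grid_measure_block\<close>)
  have xiT: "xiT \<alpha> B \<delta> T \<omega> = R.S {-T..T} / R.I {-T..T}"
    unfolding R.S_def R.I_def using \<delta> T by (intro xiT_grid) auto
  have xi: "xi \<alpha> B \<delta> \<omega> = R.S UNIV / R.I UNIV"
    unfolding R.S_def R.I_def using \<delta> by (intro xi_grid) auto
  have W: "V N = ennreal (R.W N)" for N
    by (simp add: V_def R.ennreal_W)
  show "ennreal (xiT \<alpha> B \<delta> T \<omega> powr p) \<le> ennreal (exp (p + 1)) * V UNIV"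
  proof -
    have "(R.S {-T..T} / R.I {-T..T}) powr p \<le> exp (p + 1) * R.W UNIV"
      using T p by (intro R.ratio_moment) auto
    then show ?thesis by (simp add: xiT W ennreal_mult[symmetric] R.W_nonneg)
  qed
  show "ennreal (xi \<alpha> B \<delta> \<omega> powr p) \<le> ennreal (exp (p + 1)) * V UNIV"
  proof -
    have "(R.S UNIV / R.I UNIV) powr p \<le> exp (p + 1) * R.W UNIV"
      using p by (intro R.ratio_moment) auto
    then show ?thesis by (simp add: xi W ennreal_mult[symmetric] R.W_nonneg)
  qed
  let ?N = "{m. T - 1 < \<bar>real_of_int m\<bar>}"
  have "ennreal \<bar>xiT \<alpha> B \<delta> T \<omega> powr p - xi \<alpha> B \<delta> \<omega> powr p\<bar>
      \<le> ennreal ((1 + p) * exp (2 * p + 2) * (R.W UNIV / \<rho> + \<rho> * R.W ?N))"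
    unfolding xiT xi using p T \<rho> by (intro ennreal_leI R.ratio_difference) auto
  also have "\<dots> = ennreal ((1 + p) * exp (2 * p + 2)) * (ennreal (1 / \<rho>) * V UNIV + ennreal \<rho> * V ?N)"
    using p \<rho> R.W_nonneg
    by (simp add: W ennreal_mult[symmetric] ennreal_plus[symmetric] del: ennreal_plus)
  finally show "ennreal \<bar>xiT \<alpha> B \<delta> T \<omega> powr p - xi \<alpha> B \<delta> \<omega> powr p\<bar>
      \<le> ennreal ((1 + p) * exp (2 * p + 2)) * (ennreal (1 / \<rho>) * V UNIV + ennreal \<rho> * V ?N)" .
qed

section \<open>Integration of the pathwise bounds\<close>

theorem theorem2p4:
  fixes \<alpha> p :: real
  assumes "0 < \<alpha>" and "\<alpha> < 2" and "0 < p"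
  shows "\<exists>C1>0. \<exists>C2>0. \<forall>(M::'a measure) B. is_fbm M \<alpha> B \<longrightarrow>
           (\<forall>\<delta> T. 0 \<le> \<delta> \<and> \<delta> \<le> 1 \<and> 1 \<le> T \<longrightarrow>
              \<bar>(\<integral>\<omega>. (xiT \<alpha> B \<delta> T \<omega>) powr p \<partial>M) - (\<integral>\<omega>. (xi \<alpha> B \<delta> \<omega>) powr p \<partial>M)\<bar>
                \<le> C1 * exp (- C2 * T powr \<alpha>))"
proof -
  obtain C where C: "0 < C" and Cprop: "\<And>(M::'a measure) B x. is_fbm M \<alpha> B \<Longrightarrow>
    \<exists>U\<in>borel_measurable M. (\<integral>\<^sup>+\<omega>. U \<omega> \<partial>M) \<le> ennreal (C * exp (- (\<bar>x\<bar> powr \<alpha>) / 16)) \<and>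
      (\<forall>\<omega>\<in>space M. \<forall>s\<in>{x-1..x+1}. \<forall>t\<in>{x-1..x+1}.
        ennreal (exp (Zp \<alpha> B \<omega> x / 4 + (2 * p + 1 / 2) * \<bar>Zp \<alpha> B \<omega> s - Zp \<alpha> B \<omega> t\<bar>)) \<le> U \<omega>)"
    using fbm_block_majorant[OF assms(1,2), of "2 * p + 1 / 2", where ?'a='a] assms(3) by auto
  define A where "A = enn2real (\<integral>\<^sup>+m. ennreal (exp (- (1/32) * \<bar>of_int m\<bar> powr \<alpha>)) \<partial>count_space (UNIV::int set))"
  have A: "(\<integral>\<^sup>+m. ennreal (exp (- (1/32) * \<bar>of_int m\<bar> powr \<alpha>)) \<partial>count_space (UNIV::int set)) = ennreal A" "0 \<le> A"
    unfolding A_def using nn_integral_exp_minus_powr_int[OF assms(1), of "1/32"]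
    by (auto simp: ennreal_enn2real less_top)
  define K where "K = (1 + p) * exp (2 * p + 2)"
  have K: "0 < K" using assms by (simp add: K_def)
  \<comment> \<open>\<open>exp (1/32)\<close> comes from the -1 in
    \<open>T powr \<alpha> / 4 - 1\<close>; the final 1 makes \<open>C1\<close> strictly positive,
    as \<open>A\<close> is only known to be nonnegative.\<close>
  define C1 where "C1 = K * (C * A * (1 + exp (1/32))) + 1"
  have C1: "0 < C1" using K C A by (simp add: C1_def add_nonneg_pos)
  have "\<bar>(\<integral>\<omega>. (xiT \<alpha> B \<delta> T \<omega>) powr p \<partial>M) - (\<integral>\<omega>. (xi \<alpha> B \<delta> \<omega>) powr p \<partial>M)\<bar>
      \<le> C1 * exp (- (1/256) * T powr \<alpha>)"
    if B: "is_fbm M \<alpha> B" and \<delta>: "0 \<le> \<delta>" "\<delta> \<le> 1" and T: "1 \<le> T" for M :: "'a measure" and B \<delta> T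
  proof -
    \<comment> \<open>The majorants depend on \<open>M\<close> and \<open>B\<close>, whereas
      \<open>C\<close> and \<open>A\<close> were fixed before them.\<close>
    have "\<forall>m::int. \<exists>U. U \<in> borel_measurable M \<and>
      (\<integral>\<^sup>+\<omega>. U \<omega> \<partial>M) \<le> ennreal (C * exp (- (\<bar>of_int m\<bar> powr \<alpha>) / 16)) \<and>
      (\<forall>\<omega>\<in>space M. \<forall>s\<in>block m. \<forall>t\<in>block m.
        ennreal (exp (Zp \<alpha> B \<omega> (of_int m) / 4 + (2 * p + 1 / 2) * \<bar>Zp \<alpha> B \<omega> s - Zp \<alpha> B \<omega> t\<bar>)) \<le> U \<omega>)"
      using Cprop[OF B] unfolding block_def by blast
    then obtain U where U [measurable]: "\<And>m. U m \<in> borel_measurable M"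
      and EU: "\<And>m::int. (\<integral>\<^sup>+\<omega>. U m \<omega> \<partial>M) \<le> ennreal (C * exp (- (\<bar>of_int m\<bar> powr \<alpha>) / 16))"
      and U_ge: "\<And>m \<omega> s t. \<omega> \<in> space M \<Longrightarrow> s \<in> block m \<Longrightarrow> t \<in> block m \<Longrightarrow>
        ennreal (exp (Zp \<alpha> B \<omega> (of_int m) / 4 + (2 * p + 1 / 2) * \<bar>Zp \<alpha> B \<omega> s - Zp \<alpha> B \<omega> t\<bar>)) \<le> U m \<omega>"
      by metis
    define V where "V N \<omega> = (\<integral>\<^sup>+m. U m \<omega> * indicator N m \<partial>count_space UNIV)" for N \<omega>
    have V_meas [measurable]: "V N \<in> borel_measurable M" for N
      unfolding V_def[abs_def] by (rule borel_measurable_nn_integral_count_int) measurable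
    have EV: "(\<integral>\<^sup>+\<omega>. V N \<omega> \<partial>M) \<le> ennreal (C * A * exp (- a / 32))"
      if "\<And>m. m \<in> N \<Longrightarrow> a \<le> \<bar>of_int m\<bar> powr \<alpha>" for N a
      using nn_integral_tail_bound[OF U EU less_imp_le[OF C] that, where N=N] C A(2)
      unfolding V_def A(1) by (simp add: ennreal_mult[symmetric] mult_ac)
    have EU_tot: "(\<integral>\<^sup>+\<omega>. V UNIV \<omega> \<partial>M) \<le> ennreal (C * A)"
      using EV[of UNIV 0] by simp
    \<comment> \<open>The tail has expectation of order
      \<open>exp (- (T powr \<alpha>) / 128)\<close>; taking \<rho> as the inverse square root of
      this gives both terms the rate 1/256.\<close>
    define \<rho> where "\<rho> = exp (T powr \<alpha> / 256)"
    let ?N = "{m. T - 1 < \<bar>real_of_int m\<bar>}"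
    let ?f = "\<lambda>\<omega>. xiT \<alpha> B \<delta> T \<omega> powr p" and ?g = "\<lambda>\<omega>. xi \<alpha> B \<delta> \<omega> powr p"
    have "AE \<omega> in M. V UNIV \<omega> \<noteq> \<infinity>"
      using EU_tot by (intro nn_integral_PInf_AE) (auto simp: top_unique)
    then have AE_bounds: "AE \<omega> in M. ennreal (?f \<omega>) \<le> ennreal (exp (p + 1)) * V UNIV \<omega> \<and>
        ennreal (?g \<omega>) \<le> ennreal (exp (p + 1)) * V UNIV \<omega> \<and>
        ennreal \<bar>?f \<omega> - ?g \<omega>\<bar> \<le> ennreal K * (ennreal (1 / \<rho>) * V UNIV \<omega> + ennreal \<rho> * V ?N \<omega>)"
      using fbm_zero[OF B] AE_space
    proof eventually_elim
      case (elim \<omega>)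
      have "(\<integral>\<^sup>+m. U m \<omega> \<partial>count_space UNIV) < \<infinity>"
        using elim(1) by (simp add: V_def less_top)
      note * = fbm_pointwise_bounds[OF B assms(1,3) \<delta> T _ elim(3,2), where U=U and \<rho>=\<rho>, OF _ this U_ge[OF elim(3)]]
      show ?case using * unfolding V_def K_def \<rho>_def by simp
    qed
    have Zm: "Zp \<alpha> B \<omega> \<in> borel_measurable borel" if "\<omega> \<in> space M" for \<omega>
      using Zp_continuous[OF B assms(1) that] by (rule borel_measurable_continuous_onI)
    have "xiT \<alpha> B \<delta> T \<in> borel_measurable M"
    proof (subst measurable_cong)
      show "xiT \<alpha> B \<delta> T \<omega> = (SUP t\<in>grid \<delta> \<inter> {-T..T}. exp (Zp \<alpha> B \<omega> t))
          / (\<integral>t\<in>{-T..T}. exp (Zp \<alpha> B \<omega> t) \<partial>grid_measure \<delta>)" if "\<omega> \<in> space M" for \<omega>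
        using T by (intro xiT_grid \<delta> Zm that) simp
    qed (intro borel_measurable_grid_ratio[OF B assms(1) \<delta>], simp)
    then have fm [measurable]: "?f \<in> borel_measurable M" by measurable
    have "xi \<alpha> B \<delta> \<in> borel_measurable M"
    proof (subst measurable_cong)
      show "xi \<alpha> B \<delta> \<omega> = (SUP t\<in>grid \<delta> \<inter> UNIV. exp (Zp \<alpha> B \<omega> t))
          / (\<integral>t\<in>UNIV. exp (Zp \<alpha> B \<omega> t) \<partial>grid_measure \<delta>)" if "\<omega> \<in> space M" for \<omega>
        by (intro xi_grid \<delta> Zm that)
    qed (intro borel_measurable_grid_ratio[OF B assms(1) \<delta>], simp)
    then have gm [measurable]: "?g \<in> borel_measurable M" by measurable
    \<comment> \<open>Integrability of both powers lets the difference of expectations be written as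
      the expectation of the difference.\<close>
    have int: "integrable M h"
      if [measurable]: "h \<in> borel_measurable M" and "\<And>\<omega>. 0 \<le> h \<omega>"
        and "AE \<omega> in M. ennreal (h \<omega>) \<le> ennreal (exp (p + 1)) * V UNIV \<omega>" for h
    proof (rule integrableI_nonneg)
      have "(\<integral>\<^sup>+\<omega>. ennreal (h \<omega>) \<partial>M) \<le> (\<integral>\<^sup>+\<omega>. ennreal (exp (p + 1)) * V UNIV \<omega> \<partial>M)"
        by (rule nn_integral_mono_AE) (rule that)
      also have "\<dots> = ennreal (exp (p + 1)) * (\<integral>\<^sup>+\<omega>. V UNIV \<omega> \<partial>M)"
        by (rule nn_integral_cmult) measurable
      also have "\<dots> \<le> ennreal (exp (p + 1)) * ennreal (C * A)"
        by (intro mult_left_mono EU_tot) simp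
      also have "\<dots> < \<infinity>" by (simp add: ennreal_mult_less_top)
      finally show "(\<integral>\<^sup>+\<omega>. ennreal (h \<omega>) \<partial>M) < \<infinity>" .
    qed (use that in auto)
    have fi: "integrable M ?f" and gi: "integrable M ?g"
      using AE_bounds by (auto intro!: int)
    have "ennreal \<bar>(\<integral>\<omega>. ?f \<omega> \<partial>M) - (\<integral>\<omega>. ?g \<omega> \<partial>M)\<bar> = ennreal (norm (\<integral>\<omega>. ?f \<omega> - ?g \<omega> \<partial>M))"
      using fi gi by simp
    also have "\<dots> \<le> (\<integral>\<^sup>+\<omega>. ennreal (norm (?f \<omega> - ?g \<omega>)) \<partial>M)"
      using fi gi by (intro integral_norm_bound_ennreal) simp
    also have "\<dots> \<le> (\<integral>\<^sup>+\<omega>. ennreal K * (ennreal (1 / \<rho>) * V UNIV \<omega> + ennreal \<rho> * V ?N \<omega>) \<partial>M)"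
      using AE_bounds by (intro nn_integral_mono_AE) auto
    also have "\<dots> = ennreal K * (ennreal (1 / \<rho>) * (\<integral>\<^sup>+\<omega>. V UNIV \<omega> \<partial>M) + ennreal \<rho> * (\<integral>\<^sup>+\<omega>. V ?N \<omega> \<partial>M))"
      by (simp add: nn_integral_cmult nn_integral_add)
    also have "\<dots> \<le> ennreal K * (ennreal (1 / \<rho>) * ennreal (C * A)
        + ennreal \<rho> * ennreal (C * A * exp (- (T powr \<alpha> / 4 - 1) / 32)))"
    \<comment> \<open>\<open>EV\<close> is applied with a = T^\<alpha> / 4 - 1, a lower bound of (T
      - 1)^\<alpha> and so of |m|^\<alpha> for every block of the tail.\<close>
    proof (intro mult_left_mono add_mono EU_tot EV)
      fix m assume "m \<in> ?N"
      then have "(T - 1) powr \<alpha> \<le> \<bar>of_int m\<bar> powr \<alpha>"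
        using assms T by (intro powr_mono2) auto
      then show "T powr \<alpha> / 4 - 1 \<le> \<bar>of_int m\<bar> powr \<alpha>"
        using powr_minus_one_ge[OF assms(1,2) T] by (rule order_trans[rotated])
    qed auto
    also have "\<dots> = ennreal (K * (1 / \<rho> * (C * A) + \<rho> * (C * A * exp (- (T powr \<alpha> / 4 - 1) / 32))))"
      using K C A by (simp add: \<rho>_def ennreal_mult[symmetric] ennreal_plus[symmetric] del: ennreal_plus)
    also have "K * (1 / \<rho> * (C * A) + \<rho> * (C * A * exp (- (T powr \<alpha> / 4 - 1) / 32)))
        = K * (C * A * (1 + exp (1/32))) * exp (- (1/256) * T powr \<alpha>)"
    proof -
      have "1 / \<rho> = exp (- (1/256) * T powr \<alpha>)"
        by (simp add: \<rho>_def exp_minus field_simps)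
      moreover have "\<rho> * exp (- (T powr \<alpha> / 4 - 1) / 32) = exp (1/32) * exp (- (1/256) * T powr \<alpha>)"
        unfolding \<rho>_def exp_add[symmetric] by (simp add: field_simps)
      moreover have "K * (1 / \<rho> * (C * A) + \<rho> * (C * A * y)) = K * (C * A * (1 / \<rho> + \<rho> * y))" for y
        by (simp add: algebra_simps)
      ultimately show ?thesis by (simp add: algebra_simps)
    qed
    finally have "\<bar>(\<integral>\<omega>. ?f \<omega> \<partial>M) - (\<integral>\<omega>. ?g \<omega> \<partial>M)\<bar>
        \<le> K * (C * A * (1 + exp (1/32))) * exp (- (1/256) * T powr \<alpha>)"
      using K C A by simp
    also have "\<dots> \<le> C1 * exp (- (1/256) * T powr \<alpha>)"
      by (intro mult_right_mono) (auto simp: C1_def)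
    finally show ?thesis .
  qed
  then show ?thesis
    using C1 by (intro exI[of _ C1] exI[of _ "1/256"] conjI allI impI) auto
qed

end
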